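(* Let $t\geq 2$ be an integer. Every $PG(t-1,2)$-free matroid $M$ with $|M|>(1-3\cdot 2^{-t})2^{r(M)}$ satisfies $\chi(M)\in\{t-1,t\}$.
   Context: A matroid $M$ means a simple binary matroid, represented by an integer $r(M)\geq 0$ (its rank) and a set $E(M)\subseteq \mathbb{F}_2^{r(M)}\setminus\{0\}$ that spans $\mathbb{F}_2^{r(M)}$; $|M|:=|E(M)|$. The critical number $\chi(M)$ is the smallest $k$ such that some subspace of $\mathbb{F}_2^{r(M)}$ of codimension $k$ is disjoint from $E(M)$. A matroid $M$ contains a matroid $N$ if there is an injective linear map $\iota:\mathbb{F}_2^{r(N)}\to\mathbb{F}_2^{r(M)}$ with $\iota(E(N))\subseteq E(M)$; $M$ is $N$-free if it does not contain $N$. The projective geometry $PG(t-1,2)$ is the matroid of rank $t$ with edge set $\mathbb{F}_2^t\setminus\{0\}$. *)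

theory Defs
  imports Jordan_Normal_Form.VS_Connect "HOL-Library.Z2"
begin

abbreviation F2_space :: "nat \<Rightarrow> (bit, bit vec) module" where
  "F2_space r \<equiv> module_vec TYPE(bit) r"

text \<open>
  The record only carries the data of a simple binary matroid; its axioms are the predicate
  \<open>binary_matroid\<close>. The rank has to be stored, since \<open>bit vec\<close> contains the vectors of every
  length and an empty ground set does not determine one.
\<close>

record bin_matroid =
  mrank :: nat
  ground :: "bit vec set"

definition binary_matroid :: "bin_matroid \<Rightarrow> bool" where
  "binary_matroid M \<longleftrightarrow>
     ground M \<subseteq> carrier_vec (mrank M) - {0\<^sub>v (mrank M)} \<and>
     LinearCombinations.module.span class_ring (F2_space (mrank M)) (ground M) = carrier_vec (mrank M)"

definition F2_subspace_codim :: "nat \<Rightarrow> nat \<Rightarrow> bit vec set \<Rightarrow> bool" where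
  "F2_subspace_codim r k W \<longleftrightarrow>
     VectorSpace.subspace class_ring W (F2_space r) \<and>
     vectorspace.dim class_ring ((F2_space r)\<lparr>carrier := W\<rparr>) + k = r"

definition critical_number :: "bin_matroid \<Rightarrow> nat" where
  "critical_number M = (LEAST k. \<exists>W. F2_subspace_codim (mrank M) k W \<and> W \<inter> ground M = {})"

text \<open>Maps are total on \<open>bit vec\<close>; linearity and injectivity are only asked for on vectors of
  length \<open>mrank N\<close>.\<close>

definition contains_matroid :: "bin_matroid \<Rightarrow> bin_matroid \<Rightarrow> bool" where
  "contains_matroid M N \<longleftrightarrow>
     (\<exists>\<iota>. linear_map class_ring (F2_space (mrank N)) (F2_space (mrank M)) \<iota> \<and>
          inj_on \<iota> (carrier_vec (mrank N)) \<and>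
          \<iota> ` ground N \<subseteq> ground M)"

abbreviation matroid_free :: "bin_matroid \<Rightarrow> bin_matroid \<Rightarrow> bool" where
  "matroid_free N M \<equiv> \<not> contains_matroid M N"

text \<open>Indexed by the rank: \<open>binary_PG t\<close> is $PG(t-1,2)$.\<close>

definition binary_PG :: "nat \<Rightarrow> bin_matroid" where
  "binary_PG t = \<lparr>mrank = t, ground = carrier_vec t - {0\<^sub>v t}\<rparr>"

end

theory Submission
  imports Defs "HOL-Library.Function_Algebras"
begin

text \<open>
  Write \<open>A\<close> for the ground set in \<open>V = F\<^sub>2\<^sup>r\<close>. If \<open>A\<close> is sum-free (\<open>t = 2\<close>), the cubes of the
  Fourier coefficients of \<open>A\<close> add up to 0, so some coefficient is very negative and \<open>A\<close> is
  concentrated off some hyperplane \<open>H\<close>. If \<open>A\<close> has density more than 1/3, then \<open>A - H\<close> fills more than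
  half of \<open>V - H\<close> and \<open>A\<close> misses \<open>H\<close>. If the density is only more than 1/4, put \<open>B = A - H\<close> and
  \<open>C = A \<inter> H\<close>; then \<open>|B| > |H| / 3\<close>, \<open>|B| + |C| > |H| / 2\<close> and \<open>B\<close> is independent in the Cayley graph of
  \<open>C\<close>. Were there an odd subset of \<open>C\<close> with sum 0, a shortest one, of size \<open>2k + 1\<close>, would give
  \<open>|C| \<le> (2k + 1) |H| / 4^k\<close> and bound \<open>|B|\<close> by 5/16 (\<open>k = 2\<close>), 25/64 (\<open>k = 3\<close>) or \<open>k / (2k + 1)\<close> of \<open>|H|\<close>,
  a contradiction in each case. So \<open>C\<close> misses a hyperplane of \<open>H\<close>.

  For the step from \<open>t\<close> to \<open>t + 1\<close> it is enough to find a hyperplane \<open>H\<close> such that \<open>A \<inter> H\<close> contains no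
  \<open>PG(t-1,2)\<close>. Let \<open>S\<close> be a \<open>t\<close>-dimensional subspace with nonzero elements in \<open>A\<close>, and \<open>S'\<close> a hyperplane
  of \<open>S\<close>. The union of the cosets of \<open>S'\<close> contained in \<open>A\<close> is sum-free, and an average over three choices
  of \<open>S'\<close> shows that its density exceeds 1/3 for one of them. It therefore misses a hyperplane \<open>H\<close>,
  so each coset of \<open>S'\<close> in \<open>H\<close> meets \<open>V - A\<close>. This leaves too few elements of \<open>V - A\<close> outside \<open>H\<close> to
  meet all translates off \<open>H\<close> of a \<open>PG(t-1,2)\<close> in \<open>A \<inter> H\<close>.
\<close>

section \<open>Groups of exponent two and their characters\<close>

text \<open>These groups are the vector spaces over F_2 with the scalars left out: a subgroup is a
  subspace, and a subgroup of index two is a linear hyperplane.\<close>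

class exponent_two_group = ab_group_add +
  assumes add_self [simp]: "x + x = 0"
begin

lemma add_self_left [simp]: "x + (x + y) = y"
  by (simp flip: add.assoc)

lemma add_eq_0_iff_eq: "x + y = 0 \<longleftrightarrow> x = y"
  by (metis add.right_neutral add_self add_self_left)

end

section \<open>Subspaces and hyperplanes\<close>

definition is_subgroup :: "'a::exponent_two_group set \<Rightarrow> bool" where
  "is_subgroup W \<longleftrightarrow> 0 \<in> W \<and> (\<forall>x\<in>W. \<forall>y\<in>W. x + y \<in> W)"

text \<open>Index two without quotients or dimensions: any two elements of \<open>V\<close> outside
  \<open>H\<close> lie in the same coset of \<open>H\<close>.\<close>

definition hyperplane :: "'a::exponent_two_group set \<Rightarrow> 'a set \<Rightarrow> bool" where
  "hyperplane H V \<longleftrightarrow> is_subgroup H \<and> H \<subset> V \<and> (\<forall>x\<in>V - H. \<forall>y\<in>V - H. x + y \<in> H)"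

definition sum_free :: "'a::exponent_two_group set \<Rightarrow> bool" where
  "sum_free A \<longleftrightarrow> (\<forall>x\<in>A. \<forall>y\<in>A. x + y \<notin> A)"

lemma is_subgroupD:
  assumes "is_subgroup W"
  shows "0 \<in> W" "x \<in> W \<Longrightarrow> y \<in> W \<Longrightarrow> x + y \<in> W"
  using assms by (auto simp: is_subgroup_def)

lemma subgroup_add_iff:
  assumes "is_subgroup W" "x \<in> W"
  shows "x + y \<in> W \<longleftrightarrow> y \<in> W"
  by (metis assms add_self_left is_subgroupD(2))

lemma subgroup_sum_mem:
  assumes "is_subgroup W" "\<And>i. i \<in> I \<Longrightarrow> f i \<in> W"
  shows "sum f I \<in> W"
  using assms(2) by (induction I rule: infinite_finite_induct) (auto simp: is_subgroupD[OF assms(1)])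

lemma sum_translate_subgroup:
  assumes "is_subgroup V" "y \<in> V"
  shows "(\<Sum>x\<in>V. f (x + y)) = (\<Sum>x\<in>V. f x)"
  by (rule sum.reindex_bij_witness[of _ "\<lambda>x. x + y" "\<lambda>x. x + y"])
     (use assms in \<open>auto simp: is_subgroupD add.assoc\<close>)

lemma hyperplaneD:
  assumes "hyperplane H V"
  shows "is_subgroup H" "H \<subseteq> V" "H \<noteq> V" "\<And>x y. x \<in> V - H \<Longrightarrow> y \<in> V - H \<Longrightarrow> x + y \<in> H"
  using assms by (auto simp: hyperplane_def)

lemma hyperplane_add_out:
  assumes "hyperplane H V" "is_subgroup V" "x \<in> V - H" "y \<in> H"
  shows "x + y \<in> V - H"
  using assms by (metis DiffD1 DiffD2 DiffI add.commute hyperplaneD(1,2) is_subgroupD(2) subgroup_add_iff subsetD)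

lemma card_hyperplane:
  assumes H: "hyperplane H V" and V: "is_subgroup V" "finite V"
  shows "card (V - H) = card H" "card V = 2 * card H"
proof -
  obtain c where c: "c \<in> V - H"
    using hyperplaneD(2,3)[OF H] by blast
  have "bij_betw (\<lambda>x. c + x) H (V - H)"
    by (rule bij_betw_byWitness[where f' = "\<lambda>x. c + x"])
       (use c in \<open>auto simp: hyperplane_add_out[OF H V(1) c, simplified] hyperplaneD(4)[OF H]\<close>)
  then show *: "card (V - H) = card H"
    by (metis bij_betw_same_card)
  have "card V = card H + card (V - H)"
    using H V(2) by (metis card_Diff_subset card_mono finite_subset hyperplaneD(2) le_add_diff_inverse)
  with * show "card V = 2 * card H"
    by simp
qed

text \<open>A subgroup that is maximal among those containing \<open>D\<close> and avoiding
  \<open>c\<close> works: by maximality every element of \<open>V\<close> outside it lies in the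
  coset of \<open>c\<close>.\<close>

lemma ex_hyperplane_avoiding:
  assumes V: "is_subgroup V" "finite V" and D: "is_subgroup D" "D \<subseteq> V" and c: "c \<in> V - D"
  shows "\<exists>M. hyperplane M V \<and> D \<subseteq> M \<and> c \<notin> M"
proof -
  let ?P = "{M. is_subgroup M \<and> D \<subseteq> M \<and> M \<subseteq> V \<and> c \<notin> M}"
  have "finite ?P"
    using V(2) by (auto intro: finite_subset[of _ "Pow V"])
  moreover have "D \<in> ?P"
    using D c by auto
  ultimately obtain M where M: "M \<in> ?P" and max: "\<And>N. N \<in> ?P \<Longrightarrow> M \<subseteq> N \<Longrightarrow> N = M"
    using finite_has_maximal2[of ?P D] by (metis (no_types, lifting))
  have sg: "is_subgroup M"
    using M by simp
  have dich: "x + c \<in> M" if x: "x \<in> V" "x \<notin> M" for x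
  proof (rule ccontr)
    assume nx: "x + c \<notin> M"
    \<comment> \<open>The subgroup generated by \<open>M\<close> and \<open>x\<close>. It avoids
      \<open>c\<close> as long as \<open>x + c\<close> is not in \<open>M\<close>, which contradicts
      maximality.\<close>
    let ?N = "M \<union> (\<lambda>m. x + m) ` M"
    have "is_subgroup ?N"
      unfolding is_subgroup_def
    proof (intro conjI ballI)
      show "0 \<in> ?N" using is_subgroupD(1)[OF sg] by simp
    next
      fix a b assume "a \<in> ?N" "b \<in> ?N"
      then consider "a \<in> M" "b \<in> M" | m where "a \<in> M" "m \<in> M" "b = x + m"
        | m where "m \<in> M" "b \<in> M" "a = x + m"
        | m n where "m \<in> M" "n \<in> M" "a = x + m" "b = x + n" by auto
      then show "a + b \<in> ?N"
      proof cases
        case 1 then show ?thesis using is_subgroupD(2)[OF sg] by simp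
      next
        case 2
        then have "a + b = x + (a + m)" by (simp add: add_ac)
        with 2 show ?thesis using is_subgroupD(2)[OF sg] by auto
      next
        case 3
        then have "a + b = x + (m + b)" by (simp add: add_ac)
        with 3 show ?thesis using is_subgroupD(2)[OF sg] by auto
      next
        case 4
        then have "a + b = m + n" by (metis add.assoc add.commute add_self_left)
        with 4 have "a + b \<in> M" using is_subgroupD(2)[OF sg] by metis
        then show ?thesis ..
      qed
    qed
    moreover have "c \<notin> ?N"
    proof
      assume "c \<in> ?N"
      then obtain m where "m \<in> M" "c = x + m" using M by auto
      then show False using nx by simp
    qed
    moreover have "?N \<subseteq> V"
      using M x is_subgroupD(2)[OF V(1)] by auto
    ultimately have "?N = M"
      using M by (intro max) auto
    moreover have "x \<in> ?N"
      using is_subgroupD(1)[OF sg] by (metis UnI2 add.right_neutral image_eqI)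
    ultimately show False using x by simp
  qed
  have "x + y \<in> M" if "x \<in> V - M" "y \<in> V - M" for x y
  proof -
    have "(x + c) + (y + c) \<in> M"
      using that dich is_subgroupD(2)[OF sg] by auto
    then show ?thesis by (simp add: add_ac)
  qed
  then have "hyperplane M V"
    using M c by (auto simp: hyperplane_def)
  then show ?thesis using M by auto
qed

text \<open>The value 0 outside \<open>V\<close> makes equality of functions the same as equality on
  \<open>V\<close>, so the characters of a finite \<open>V\<close> form a finite set.\<close>

definition characters :: "'a::exponent_two_group set \<Rightarrow> ('a \<Rightarrow> real) set" where
  "characters V = {\<chi>. (\<forall>x\<in>V. \<chi> x = 1 \<or> \<chi> x = -1) \<and>
     (\<forall>x\<in>V. \<forall>y\<in>V. \<chi> (x + y) = \<chi> x * \<chi> y) \<and> (\<forall>x. x \<notin> V \<longrightarrow> \<chi> x = 0)}"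

definition trivial_character :: "'a::exponent_two_group set \<Rightarrow> 'a \<Rightarrow> real" where
  "trivial_character V = (\<lambda>x. if x \<in> V then 1 else 0)"

lemma charactersD:
  assumes "\<chi> \<in> characters V"
  shows "x \<in> V \<Longrightarrow> \<chi> x = 1 \<or> \<chi> x = -1"
    "x \<in> V \<Longrightarrow> y \<in> V \<Longrightarrow> \<chi> (x + y) = \<chi> x * \<chi> y" "x \<notin> V \<Longrightarrow> \<chi> x = 0"
  using assms by (auto simp: characters_def)

lemma finite_characters:
  assumes "finite V"
  shows "finite (characters V)"
proof -
  have "characters V \<subseteq> {\<chi>. \<forall>x. (x \<in> V \<longrightarrow> \<chi> x \<in> {1, -1}) \<and> (x \<notin> V \<longrightarrow> \<chi> x = 0)}"
    by (auto simp: characters_def)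
  then show ?thesis
    using finite_set_of_finite_funs[OF assms, of "{1, -1}" "0::real"] finite_subset by blast
qed

lemma trivial_character_mem: "is_subgroup V \<Longrightarrow> trivial_character V \<in> characters V"
  by (auto simp: characters_def trivial_character_def is_subgroupD)

lemma character_mult_mem:
  assumes "is_subgroup V" "\<chi> \<in> characters V" "\<psi> \<in> characters V"
  shows "(\<lambda>x. \<chi> x * \<psi> x) \<in> characters V"
proof -
  note \<chi> = charactersD[OF assms(2)] and \<psi> = charactersD[OF assms(3)]
  have "\<chi> x * \<psi> x = 1 \<or> \<chi> x * \<psi> x = -1" if "x \<in> V" for x
    using \<chi>(1)[OF that] \<psi>(1)[OF that] by auto
  moreover have "\<chi> (x + y) * \<psi> (x + y) = (\<chi> x * \<psi> x) * (\<chi> y * \<psi> y)" if "x \<in> V" "y \<in> V" for x y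
    using \<chi>(2)[OF that] \<psi>(2)[OF that] by simp
  ultimately show ?thesis
    using \<chi>(3) unfolding characters_def by simp
qed

lemma hyperplane_character_mem:
  assumes "hyperplane H V" "is_subgroup V"
  shows "(\<lambda>x. if x \<in> H then 1 else if x \<in> V then -1 else 0) \<in> characters V"
proof -
  note H = hyperplaneD[OF assms(1)]
  have "x + y \<in> H \<longleftrightarrow> (x \<in> H \<longleftrightarrow> y \<in> H)" if "x \<in> V" "y \<in> V" for x y
    using that H subgroup_add_iff[OF H(1)] by (metis DiffI add.commute)
  then show ?thesis
    using H(2) is_subgroupD(2)[OF assms(2)] by (auto simp: characters_def)
qed

lemma ex_character_neg:
  assumes V: "is_subgroup V" "finite V" and x: "x \<in> V" "x \<noteq> 0"
  shows "\<exists>\<chi>\<in>characters V. \<chi> x = -1"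
proof -
  have "is_subgroup {0::'a}"
    by (simp add: is_subgroup_def)
  then obtain M where M: "hyperplane M V" "x \<notin> M"
    using ex_hyperplane_avoiding[OF V, of "{0}" x] x is_subgroupD(1)[OF V(1)] by auto
  show ?thesis
    by (rule bexI[OF _ hyperplane_character_mem[OF M(1) V(1)]]) (use M x in auto)
qed

text \<open>Multiplication by a character with value -1 at \<open>x\<close> permutes the characters
  and changes the sign of the sum.\<close>

lemma sum_characters_eq_0:
  assumes V: "is_subgroup V" "finite V" and x: "x \<in> V" "x \<noteq> 0"
  shows "(\<Sum>\<chi>\<in>characters V. \<chi> x) = 0"
proof -
  obtain \<psi> where \<psi>: "\<psi> \<in> characters V" "\<psi> x = -1"
    using ex_character_neg[OF assms] by blast
  have sq: "\<psi> y * (\<psi> y * \<chi> y) = \<chi> y" if "\<chi> \<in> characters V" for \<chi> y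
    using charactersD(1,3)[OF \<psi>(1), of y] charactersD(3)[OF that, of y] by (cases "y \<in> V") auto
  have "(\<Sum>\<chi>\<in>characters V. \<chi> x) = (\<Sum>\<chi>\<in>characters V. \<psi> x * \<chi> x)"
    by (rule sum.reindex_bij_witness[of _ "\<lambda>\<chi> y. \<psi> y * \<chi> y" "\<lambda>\<chi> y. \<psi> y * \<chi> y"])
       (auto simp: sq character_mult_mem[OF V(1) \<psi>(1)])
  also have "\<dots> = - (\<Sum>\<chi>\<in>characters V. \<chi> x)"
    by (simp add: \<psi>(2) sum_negf)
  finally show ?thesis by simp
qed

lemma sum_character_eq_0:
  assumes V: "is_subgroup V" and \<chi>: "\<chi> \<in> characters V" "\<chi> \<noteq> trivial_character V"
  shows "(\<Sum>x\<in>V. \<chi> x) = 0"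
proof -
  obtain y where y: "y \<in> V" "\<chi> y = -1"
    using \<chi> charactersD[OF \<chi>(1)] by (fastforce simp: trivial_character_def)
  have "(\<Sum>x\<in>V. \<chi> x) = (\<Sum>x\<in>V. \<chi> (x + y))"
    using sum_translate_subgroup[OF V y(1)] by metis
  also have "\<dots> = (\<Sum>x\<in>V. \<chi> x * \<chi> y)"
    using charactersD(2)[OF \<chi>(1)] y(1) by (intro sum.cong) auto
  also have "\<dots> = - (\<Sum>x\<in>V. \<chi> x)"
    by (simp add: y sum_negf)
  finally show ?thesis by simp
qed

lemma character_zero:
  assumes "is_subgroup V" "\<chi> \<in> characters V"
  shows "\<chi> 0 = 1"
  using charactersD(1,2)[OF assms(2), of 0] charactersD(2)[OF assms(2), of 0 0] is_subgroupD(1)[OF assms(1)]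
  by auto

text \<open>The double sum of \<open>\<chi> x\<close> over all characters and all points is
  evaluated in both orders. Orthogonality leaves only the point 0 in one order and only the trivial
  character in the other.\<close>

lemma card_characters:
  assumes V: "is_subgroup V" "finite V"
  shows "card (characters V) = card V"
proof -
  have 0: "0 \<in> V" using is_subgroupD(1)[OF V(1)] .
  have "real (card (characters V)) = (\<Sum>\<chi>\<in>characters V. \<chi> 0)"
    by (simp add: character_zero[OF V(1)] cong: sum.cong)
  also have "\<dots> = (\<Sum>x\<in>V. \<Sum>\<chi>\<in>characters V. \<chi> x)"
    using sum.remove[OF V(2) 0, of "\<lambda>x. \<Sum>\<chi>\<in>characters V. \<chi> x"] sum_characters_eq_0[OF V] by simp
  also have "\<dots> = (\<Sum>\<chi>\<in>characters V. \<Sum>x\<in>V. \<chi> x)"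
    by (rule sum.swap)
  also have "\<dots> = (\<Sum>x\<in>V. trivial_character V x)"
    using sum.remove[OF finite_characters[OF V(2)] trivial_character_mem[OF V(1)], of "\<lambda>\<chi>. \<Sum>x\<in>V. \<chi> x"]
      sum_character_eq_0[OF V(1)] by simp
  also have "\<dots> = real (card V)"
    by (simp add: trivial_character_def)
  finally show ?thesis by simp
qed

lemma sum_characters:
  assumes "is_subgroup V" "finite V" "x \<in> V"
  shows "(\<Sum>\<chi>\<in>characters V. \<chi> x) = (if x = 0 then card V else 0)"
  using assms sum_characters_eq_0[OF assms] card_characters[OF assms(1,2)]
  by (simp add: character_zero[OF assms(1)] cong: sum.cong)

text \<open>For the character sums \<open>s\<close> over \<open>A\<close>, the squares add up to
  |A||V|, and the cubes to 0 because no three elements of \<open>A\<close> have sum 0. Without the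
  trivial character these totals become |A|(|V| - |A|) and -|A|^3, so the least remaining
  \<open>s \<chi>\<close> satisfies \<open>s \<chi>\<close> (|V| - |A|) \<le> -|A|^2. The kernel of
  this character is the hyperplane.\<close>

lemma sum_free_large_outside_hyperplane:
  assumes V: "is_subgroup V" "finite V" and A: "A \<subseteq> V" "sum_free A" "A \<noteq> {}"
  shows "\<exists>H. hyperplane H V \<and> card A * card V \<le> 2 * card (A - H) * card (V - A)"
proof -
  have finA: "finite A" using A(1) V(2) finite_subset by blast
  let ?X = "characters V" and ?one = "trivial_character V"
  define s where "s \<chi> = (\<Sum>a\<in>A. \<chi> a)" for \<chi> :: "'a \<Rightarrow> real"
  have finX: "finite ?X" using finite_characters[OF V(2)] .
  have AV: "a \<in> A \<Longrightarrow> a \<in> V" for a using A(1) by blast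
  have s_one: "s ?one = card A"
    using AV by (simp add: s_def trivial_character_def)
  have sq: "s \<chi> * s \<chi> = (\<Sum>a\<in>A. \<Sum>b\<in>A. \<chi> (a + b))" if "\<chi> \<in> ?X" for \<chi>
    unfolding s_def sum_product using charactersD(2)[OF that] AV by (intro sum.cong refl) simp
  have cube: "s \<chi> * s \<chi> * s \<chi> = (\<Sum>a\<in>A. \<Sum>b\<in>A. \<Sum>c\<in>A. \<chi> (a + b + c))" if "\<chi> \<in> ?X" for \<chi>
    unfolding sq[OF that] unfolding s_def sum_distrib_right sum_distrib_left
    using charactersD(2)[OF that] AV is_subgroupD(2)[OF V(1)] by (intro sum.cong refl) simp
  have "(\<Sum>\<chi>\<in>?X. s \<chi> * s \<chi>) = (\<Sum>a\<in>A. \<Sum>b\<in>A. \<Sum>\<chi>\<in>?X. \<chi> (a + b))"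
    by (simp add: sq sum.swap[of _ ?X A] cong: sum.cong)
  also have "\<dots> = (\<Sum>a\<in>A. \<Sum>b\<in>A. if b = a then real (card V) else 0)"
    using AV is_subgroupD(2)[OF V(1)]
    by (intro sum.cong refl) (auto simp: sum_characters[OF V] add_eq_0_iff_eq)
  also have "\<dots> = real (card A) * card V"
    using finA by simp
  finally have S2: "(\<Sum>\<chi>\<in>?X. s \<chi> * s \<chi>) = real (card A) * card V" .
  have "(\<Sum>\<chi>\<in>?X. s \<chi> * s \<chi> * s \<chi>) = (\<Sum>a\<in>A. \<Sum>b\<in>A. \<Sum>c\<in>A. \<Sum>\<chi>\<in>?X. \<chi> (a + b + c))"
    by (simp add: cube sum.swap[of _ ?X A] cong: sum.cong)
  also have "\<dots> = (\<Sum>a\<in>A. \<Sum>b\<in>A. \<Sum>c\<in>A. 0)"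
    using AV is_subgroupD(2)[OF V(1)] A(2)
    by (intro sum.cong refl) (auto simp: sum_characters[OF V] add_eq_0_iff_eq sum_free_def)
  also have "\<dots> = 0" by simp
  finally have S3: "(\<Sum>\<chi>\<in>?X. s \<chi> * s \<chi> * s \<chi>) = 0" .
  let ?Y = "?X - {?one}"
  have T2: "(\<Sum>\<chi>\<in>?Y. s \<chi> * s \<chi>) = real (card A) * card V - real (card A) * card A"
    using S2 sum.remove[OF finX trivial_character_mem[OF V(1)], of "\<lambda>\<chi>. s \<chi> * s \<chi>"] s_one by simp
  have T3: "(\<Sum>\<chi>\<in>?Y. s \<chi> * s \<chi> * s \<chi>) = - (real (card A) * card A * card A)"
    using S3 sum.remove[OF finX trivial_character_mem[OF V(1)], of "\<lambda>\<chi>. s \<chi> * s \<chi> * s \<chi>"] s_one by simp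
  have cA: "card A > 0" using A(3) finA by (simp add: card_gt_0_iff)
  \<comment> \<open>An empty sum would be 0, whereas \<open>T3\<close> gives -|A|^3.\<close>
  have "?Y \<noteq> {}"
    using T3 cA by (intro notI) simp
  then obtain \<chi> where \<chi>: "\<chi> \<in> ?Y" "\<And>\<psi>. \<psi> \<in> ?Y \<Longrightarrow> s \<chi> \<le> s \<psi>"
    using finX arg_min_if_finite[of ?Y s] by (metis finite_Diff linorder_not_less)
  have "s \<chi> * (\<Sum>\<psi>\<in>?Y. s \<psi> * s \<psi>) \<le> (\<Sum>\<psi>\<in>?Y. s \<psi> * s \<psi> * s \<psi>)"
    unfolding sum_distrib_left
    by (intro sum_mono) (metis \<chi>(2) mult.commute mult_right_mono zero_le_square)
  then have "real (card A) * (s \<chi> * (real (card V) - card A) + real (card A) * card A) \<le> 0"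
    unfolding T2 T3 by (simp add: algebra_simps)
  then have main: "s \<chi> * (real (card V) - card A) + real (card A) * card A \<le> 0"
    using cA by (simp add: mult_le_0_iff)
  define H where "H = {x\<in>V. \<chi> x = 1}"
  have \<chi>X: "\<chi> \<in> ?X" using \<chi> by simp
  have out: "x \<in> V - H \<longleftrightarrow> x \<in> V \<and> \<chi> x = -1" for x
    using charactersD(1)[OF \<chi>X, of x] by (auto simp: H_def)
  have "H \<noteq> V"
  proof
    assume "H = V"
    then have "\<chi> = ?one"
      using charactersD(3)[OF \<chi>X] by (fastforce simp: trivial_character_def H_def)
    with \<chi> show False by simp
  qed
  moreover have "is_subgroup H"
    using is_subgroupD[OF V(1)] character_zero[OF V(1) \<chi>X] charactersD(2)[OF \<chi>X]
    by (auto simp: H_def is_subgroup_def)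
  moreover have "x + y \<in> H" if "x \<in> V - H" "y \<in> V - H" for x y
    using that is_subgroupD(2)[OF V(1)] charactersD(2)[OF \<chi>X] unfolding out by (simp add: H_def)
  moreover have "H \<subseteq> V" by (auto simp: H_def)
  ultimately have "hyperplane H V"
    unfolding hyperplane_def by blast
  moreover have "s \<chi> = real (card (A \<inter> H)) - card (A - H)"
  proof -
    have "s \<chi> = (\<Sum>a\<in>A \<inter> H. \<chi> a) + (\<Sum>a\<in>A - H. \<chi> a)"
      unfolding s_def using finA by (metis sum.Int_Diff)
    moreover have "(\<Sum>a\<in>A \<inter> H. \<chi> a) = (\<Sum>a\<in>A \<inter> H. 1)"
      by (intro sum.cong) (auto simp: H_def)
    moreover have "(\<Sum>a\<in>A - H. \<chi> a) = (\<Sum>a\<in>A - H. -1)"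
      using out AV by (intro sum.cong) auto
    ultimately show ?thesis by simp
  qed
  moreover have "real (card A) = real (card (A \<inter> H)) + card (A - H)"
    using finA by (metis card_Int_Diff of_nat_add)
  ultimately have "hyperplane H V" and e: "s \<chi> = card A - 2 * real (card (A - H))"
    by auto
  have "card (V - A) = card V - card A" "card A \<le> card V"
    using A(1) V(2) finA by (auto simp: card_Diff_subset card_mono)
  then have r: "real (card (V - A)) = real (card V) - card A" by simp
  have "real (card A * card V) \<le> real (2 * card (A - H) * card (V - A))"
    using main unfolding e of_nat_mult r by (simp add: algebra_simps)
  with \<open>hyperplane H V\<close> show ?thesis
    by (metis of_nat_le_iff)
qed

text \<open>The density pushes \<open>A - H\<close> above half of \<open>V - H\<close>. An element
  \<open>c\<close> of \<open>A\<close> in \<open>H\<close> would make \<open>A - H\<close> and its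
  translate by \<open>c\<close> disjoint inside \<open>V - H\<close>, which leaves no room.\<close>

lemma sum_free_third:
  assumes V: "is_subgroup V" "finite V" and A: "A \<subseteq> V" "sum_free A" "3 * card A > card V"
  shows "\<exists>H. hyperplane H V \<and> A \<inter> H = {}"
proof -
  have "A \<noteq> {}" using A(3) by auto
  then obtain H where H: "hyperplane H V" "card A * card V \<le> 2 * card (A - H) * card (V - A)"
    using sum_free_large_outside_hyperplane[OF V A(1,2)] by blast
  have finA: "finite A" using A(1) V(2) finite_subset by blast
  have cV: "card (V - A) = card V - card A" "card A \<le> card V"
    using A(1) V(2) finA by (auto simp: card_Diff_subset card_mono)
  have "2 * card (A - H) > card (V - H)"
  proof (rule ccontr)
    assume "\<not> ?thesis"
    then have "2 * (2 * card (A - H)) \<le> card V"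
      using card_hyperplane[OF H(1) V] by linarith
    then have "2 * (card A * card V) \<le> card V * card (V - A)"
      using H(2) mult_le_mono1[of "2 * (2 * card (A - H))" "card V" "card (V - A)"] by linarith
    then have "card V * (2 * card A) \<le> card V * card (V - A)"
      by (simp add: mult_ac)
    moreover have "card V > 0" using A(3) cV(2) by linarith
    ultimately have "2 * card A \<le> card (V - A)" by simp
    then show False using A(3) cV by linarith
  qed
  moreover have "c \<notin> A" if c: "c \<in> H" for c
  proof
    assume cA: "c \<in> A"
    let ?B = "A - H" and ?B' = "(\<lambda>x. x + c) ` (A - H)"
    have "card ?B' = card ?B"
      by (intro card_image inj_onI) simp
    moreover have "?B \<inter> ?B' = {}"
      using A(2) cA by (auto simp: sum_free_def)
    moreover have "?B \<union> ?B' \<subseteq> V - H"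
      using A(1) hyperplane_add_out[OF H(1) V(1) _ c] by auto
    then have "card (?B \<union> ?B') \<le> card (V - H)"
      using V(2) by (intro card_mono) auto
    ultimately have "2 * card ?B \<le> card (V - H)"
      using finA by (simp add: card_Un_disjoint)
    with \<open>2 * card (A - H) > card (V - H)\<close> show False by simp
  qed
  ultimately show ?thesis using H(1) by blast
qed

section \<open>Families of even sets\<close>

lemma sum_sym_diff:
  fixes f :: "'b \<Rightarrow> 'a::exponent_two_group"
  assumes "finite A" "finite B"
  shows "sum f (sym_diff A B) = sum f A + sum f B"
proof -
  have "sum f A + sum f B = (sum f (A \<inter> B) + sum f (A - B)) + (sum f (A \<inter> B) + sum f (B - A))"
    using sum.Int_Diff[OF assms(1), of f B] sum.Int_Diff[OF assms(2), of f A] by (simp add: Int_commute)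
  also have "\<dots> = sum f (A - B) + sum f (B - A)"
    by (metis add.assoc add.commute add_self_left)
  also have "\<dots> = sum f (sym_diff A B)"
    using assms by (intro sum.union_disjoint[symmetric]) auto
  finally show ?thesis ..
qed

lemma card_sym_diff:
  assumes "finite A" "finite B"
  shows "card (sym_diff A B) + 2 * card (A \<inter> B) = card A + card B"
proof -
  have "card (sym_diff A B) = card (A - B) + card (B - A)"
    using assms by (intro card_Un_disjoint) auto
  then show ?thesis
    using card_Int_Diff[OF assms(1), of B] card_Int_Diff[OF assms(2), of A] by (simp add: Int_commute)
qed

lemma even_card_sym_diff:
  assumes "finite A" "finite B"
  shows "even (card (sym_diff A B)) \<longleftrightarrow> (even (card A) \<longleftrightarrow> even (card B))"
  using card_sym_diff[OF assms] by presburger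

text \<open>Under symmetric difference these sets form a group, and for finite \<open>E\<close>
  taking sums is a homomorphism on it. They serve as index set for translates along a zero-sum set
  \<open>E\<close>.\<close>

definition even_subsets :: "'a set \<Rightarrow> 'a set set" where
  "even_subsets E = {S. S \<subseteq> E \<and> even (card S)}"

lemma finite_even_subsets: "finite E \<Longrightarrow> finite (even_subsets E)"
  by (simp add: even_subsets_def)

lemma even_subsets_sym_diff:
  assumes "finite E" "S \<in> even_subsets E" "T \<in> even_subsets E"
  shows "sym_diff S T \<in> even_subsets E"
  using assms even_card_sym_diff[of S T] finite_subset[of _ E] by (auto simp: even_subsets_def)

text \<open>An even set is determined by its part away from \<open>x\<close>, since parity decides
  whether \<open>x\<close> belongs to it.\<close>

lemma card_even_subsets:
  assumes "finite E" "x \<in> E"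
  shows "card (even_subsets E) = 2 ^ (card E - 1)"
proof -
  have fin: "T \<subseteq> E \<Longrightarrow> finite T" for T
    using assms(1) finite_subset by blast
  have "bij_betw (\<lambda>S. S - {x}) (even_subsets E) (Pow (E - {x}))"
  proof (rule bij_betw_byWitness[where f' = "\<lambda>T. if even (card T) then T else insert x T"])
    show "\<forall>S\<in>even_subsets E. (if even (card (S - {x})) then S - {x} else insert x (S - {x})) = S"
    proof
      fix S assume "S \<in> even_subsets E"
      then have "finite S" "even (card S)" using fin by (auto simp: even_subsets_def)
      then show "(if even (card (S - {x})) then S - {x} else insert x (S - {x})) = S"
        by (cases "x \<in> S") (auto simp: card_Diff_singleton card_gt_0_iff)
    qed
    show "\<forall>T\<in>Pow (E - {x}). (if even (card T) then T else insert x T) - {x} = T"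
      by auto
    show "(\<lambda>S. S - {x}) ` even_subsets E \<subseteq> Pow (E - {x})"
      by (auto simp: even_subsets_def)
    show "(\<lambda>T. if even (card T) then T else insert x T) ` Pow (E - {x}) \<subseteq> even_subsets E"
    proof (intro image_subsetI)
      fix T assume T: "T \<in> Pow (E - {x})"
      then have "finite T" "x \<notin> T" "T \<subseteq> E" using fin by auto
      then show "(if even (card T) then T else insert x T) \<in> even_subsets E"
        using assms(2) by (auto simp: even_subsets_def)
    qed
  qed
  then have "card (even_subsets E) = card (Pow (E - {x}))"
    by (rule bij_betw_same_card)
  then show ?thesis
    using assms by (simp add: card_Pow)
qed

text \<open>Pairwise intersecting pairs form a star, with at most |E| - 1 edges, or lie in a
  triangle, with at most 3 edges; the assumption on |E| covers the triangle.\<close>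

lemma card_intersecting_pairs:
  assumes E: "finite E" "card E \<ge> 4"
    and P: "\<And>S. S \<in> P \<Longrightarrow> S \<subseteq> E \<and> card S = 2" "\<And>S T. S \<in> P \<Longrightarrow> T \<in> P \<Longrightarrow> S \<inter> T \<noteq> {}"
  shows "card P \<le> card E - 1"
proof (cases "\<exists>z\<in>E. \<forall>S\<in>P. z \<in> S")
  case True
  then obtain z where z: "z \<in> E" "\<And>S. S \<in> P \<Longrightarrow> z \<in> S" by blast
  have "P \<subseteq> (\<lambda>y. {z, y}) ` (E - {z})"
  proof
    fix S assume S: "S \<in> P"
    then obtain u v where "S = {u, v}" "u \<noteq> v" using P(1) by (meson card_2_iff)
    then show "S \<in> (\<lambda>y. {z, y}) ` (E - {z})"
      using z(2)[OF S] P(1)[OF S] by (auto simp: insert_commute)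
  qed
  then have "card P \<le> card (E - {z})"
    using E(1) surj_card_le by blast
  then show ?thesis using z(1) by simp
next
  case False
  show ?thesis
  proof (cases "P = {}")
    case False
    then obtain S where S: "S \<in> P" by blast
    then obtain a b where ab: "S = {a, b}" "a \<noteq> b" "a \<in> E" "b \<in> E"
      using P(1) by (metis card_2_iff insert_subset)
    obtain T where T: "T \<in> P" "a \<notin> T"
      using \<open>\<not> (\<exists>z\<in>E. \<forall>S\<in>P. z \<in> S)\<close> ab by blast
    obtain U where U: "U \<in> P" "b \<notin> U"
      using \<open>\<not> (\<exists>z\<in>E. \<forall>S\<in>P. z \<in> S)\<close> ab by blast
    have "b \<in> T" "a \<in> U"
      using P(2)[OF S T(1)] P(2)[OF S U(1)] T U ab by auto
    obtain u v where "T = {u, v}" "u \<noteq> v" using P(1)[OF T(1)] by (meson card_2_iff)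
    with \<open>b \<in> T\<close> obtain c where c: "T = {b, c}" "b \<noteq> c" by blast
    obtain u v where "U = {u, v}" "u \<noteq> v" using P(1)[OF U(1)] by (meson card_2_iff)
    with \<open>a \<in> U\<close> obtain d where d: "U = {a, d}" "a \<noteq> d" by blast
    have "c = d" using P(2)[OF T(1) U(1)] c d T U by auto
    have "P \<subseteq> {{a, b}, {b, c}, {a, c}}"
    proof
      fix R assume R: "R \<in> P"
      then obtain u v where uv: "R = {u, v}" "u \<noteq> v" using P(1) by (meson card_2_iff)
      show "R \<in> {{a, b}, {b, c}, {a, c}}"
        using P(2)[OF R S] P(2)[OF R T(1)] P(2)[OF R U(1)] uv ab c d T(2) U(2) \<open>c = d\<close>
        by (auto simp: insert_commute)
    qed
    then have "card P \<le> card {{a, b}, {b, c}, {a, c}}"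
      by (intro card_mono) auto
    also have "\<dots> \<le> 3"
      by (simp add: card_insert_if)
    finally show ?thesis using E(2) by linarith
  qed simp
qed

text \<open>Translating by a member \<open>Z\<close> turns the other members into pairs. Two of
  these pairs must meet, as disjoint ones would differ in four elements, so there are at most |E| -
  1 of them.\<close>

lemma card_even_subsets_diameter_two:
  assumes E: "finite E" "card E \<ge> 4" and F: "F \<subseteq> even_subsets E"
    and diam: "\<And>S T. S \<in> F \<Longrightarrow> T \<in> F \<Longrightarrow> card (sym_diff S T) \<le> 2"
  shows "card F \<le> card E"
proof (cases "F = {}")
  case False
  then obtain Z where Z: "Z \<in> F" by blast
  define P where "P = sym_diff Z ` (F - {Z})"
  have fin: "finite S" "S \<subseteq> E" "even (card S)" if "S \<in> F" for S
    using that F finite_subset[OF _ E(1), of S] by (auto simp: even_subsets_def)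
  have inj: "inj_on (sym_diff Z) (F - {Z})"
    by (rule inj_onI) blast
  have pair: "card (sym_diff Z S) = 2" if "S \<in> F - {Z}" for S
  proof -
    have "finite (sym_diff Z S)" "sym_diff Z S \<noteq> {}"
      using that fin Z by auto
    then have "card (sym_diff Z S) \<noteq> 0" by (metis card_eq_0_iff)
    moreover have "even (card (sym_diff Z S))"
      using that fin Z by (subst even_card_sym_diff) auto
    moreover have "card (sym_diff Z S) \<le> 2"
      using that diam[OF Z] by simp
    ultimately show ?thesis by presburger
  qed
  have "card P \<le> card E - 1"
  proof (rule card_intersecting_pairs[OF E])
    show "S \<subseteq> E \<and> card S = 2" if "S \<in> P" for S
      using that pair fin Z by (auto simp: P_def)
    show "S \<inter> T \<noteq> {}" if "S \<in> P" "T \<in> P" for S T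
    proof -
      obtain S' T' where ST: "S' \<in> F - {Z}" "S = sym_diff Z S'" "T' \<in> F - {Z}" "T = sym_diff Z T'"
        using \<open>S \<in> P\<close> \<open>T \<in> P\<close> unfolding P_def by blast
      have eq: "sym_diff S T = sym_diff S' T'"
        unfolding ST by blast
      have fST: "finite S" "finite T" using ST fin Z by auto
      have "card S = 2" "card T = 2"
        using ST pair by simp_all
      moreover have "card (sym_diff S T) \<le> 2"
        unfolding eq using ST diam by simp
      ultimately have "card (S \<inter> T) \<noteq> 0"
        using card_sym_diff[OF fST] by linarith
      then show ?thesis by auto
    qed
  qed
  moreover have "card P = card (F - {Z})"
    unfolding P_def by (rule card_image[OF inj])
  moreover have "finite F"
    using F E(1) finite_even_subsets finite_subset by blast
  ultimately show ?thesis
    using Z E(2) by (simp add: card_Diff_singleton)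
qed simp

text \<open>The 20 booleans are the memberships in an independent set along a 5-cycle (index \<open>j\<close>)
  of translates by the four elements of a Klein four-group.\<close>

lemma five_cycle_square_bound:
  fixes p q r s :: "nat \<Rightarrow> bool"
  assumes pq: "\<And>j. j < 5 \<Longrightarrow> \<not> (p j \<and> q (Suc j mod 5))" "\<And>j. j < 5 \<Longrightarrow> \<not> (q j \<and> p (Suc j mod 5))"
    and rs: "\<And>j. j < 5 \<Longrightarrow> \<not> (r j \<and> s (Suc j mod 5))" "\<And>j. j < 5 \<Longrightarrow> \<not> (s j \<and> r (Suc j mod 5))"
    and sq: "\<And>j. j < 5 \<Longrightarrow> \<not> ((p j \<or> q j) \<and> (r j \<or> s j))"
  shows "(\<Sum>j<5. of_bool (p j) + of_bool (q j) + of_bool (r j) + of_bool (s j) :: nat) \<le> 8"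
proof -
  define f where "f j = (of_bool (p j) + of_bool (q j) + of_bool (r j) + of_bool (s j) :: nat)" for j
  \<comment> \<open>\<open>I\<close> and \<open>J\<close> mark the positions where a whole diagonal
    of the square is used; only there can \<open>f\<close> reach its maximum 2.\<close>
  define I where "I j \<longleftrightarrow> p j \<and> q j" for j
  define J where "J j \<longleftrightarrow> r j \<and> s j" for j
  have f1: "f j \<le> 1 + of_bool (I j) + of_bool (J j)" if "j < 5" for j
    using sq[OF that] by (auto simp: f_def I_def J_def)
  have IJ: "\<not> (I j \<and> J j)" if "j < 5" for j
    using sq[OF that] by (auto simp: I_def J_def)
  have II: "\<not> (I j \<and> I (Suc j mod 5))" "\<not> (J j \<and> J (Suc j mod 5))" if "j < 5" for j
    using pq(1)[OF that] rs(1)[OF that] by (auto simp: I_def J_def)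
  \<comment> \<open>One neighbouring position excludes \<open>p\<close> and \<open>q\<close>, the
    other excludes \<open>r\<close> and \<open>s\<close>.\<close>
  have mid: "f (Suc j mod 5) = 0" if "j < 5" "I j \<and> J (Suc (Suc j) mod 5) \<or> J j \<and> I (Suc (Suc j) mod 5)" for j
  proof -
    have "Suc j mod 5 < 5" by simp
    note nxt = pq[OF this] rs[OF this]
    have "\<not> p (Suc j mod 5)" "\<not> q (Suc j mod 5)" "\<not> r (Suc j mod 5)" "\<not> s (Suc j mod 5)"
      using that pq[of j] rs[of j] nxt unfolding I_def J_def mod_Suc_eq by blast+
    then show ?thesis by (simp add: f_def)
  qed
  have f2: "f j \<le> 2" if "j < 5" for j
    using f1[OF that] IJ[OF that] by (cases "I j"; cases "J j") auto
  \<comment> \<open>Along four consecutive full positions the diagonals alternate, so the first and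
    the last use different ones, and the fifth position lies between them.\<close>
  have chain: "f e = 0"
    if two: "f a = 2" "f b = 2" "f c = 2" "f d = 2"
      and less: "a < 5" "b < 5" "c < 5" "d < 5"
      and cyc: "b = Suc a mod 5" "c = Suc b mod 5" "d = Suc c mod 5" "e = Suc d mod 5" "a = Suc (Suc d) mod 5"
    for a b c d e
  proof -
    have "I j \<or> J j" if "f j = 2" "j < 5" for j
      using f1[OF that(2)] that(1) by (cases "I j"; cases "J j") auto
    then have "I a \<or> J a" "I b \<or> J b" "I c \<or> J c" "I d \<or> J d"
      using two less by blast+
    moreover have "\<not> (I a \<and> I b)" "\<not> (J a \<and> J b)" "\<not> (I b \<and> I c)" "\<not> (J b \<and> J c)" "\<not> (I c \<and> I d)" "\<not> (J c \<and> J d)"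
      using II[OF less(1), folded cyc(1)] II[OF less(2), folded cyc(2)] II[OF less(3), folded cyc(3)] by simp_all
    ultimately have "I d \<and> J a \<or> J d \<and> I a"
      by blast
    then show ?thesis
      using mid[OF less(4), folded cyc(4,5)] by simp
  qed
  have "f 0 + f 1 + f 2 + f 3 + f 4 \<le> 8"
  proof (rule ccontr)
    assume big: "\<not> ?thesis"
    have le: "f 0 \<le> 2" "f 1 \<le> 2" "f 2 \<le> 2" "f 3 \<le> 2" "f 4 \<le> 2"
      by (simp_all add: f2)
    then have pos: "f 0 \<noteq> 0" "f 1 \<noteq> 0" "f 2 \<noteq> 0" "f 3 \<noteq> 0" "f 4 \<noteq> 0"
      using big by linarith+
    \<comment> \<open>With total at least 9 no position is empty, so each run of four consecutive
      positions has sum at most 7. Adding the five runs gives four times the total at most 35, which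
      is impossible.\<close>
    have seven: "f a + f b + f c + f d \<le> 7" if "f e \<noteq> 0" "a < 5" "b < 5" "c < 5" "d < 5"
      "b = Suc a mod 5" "c = Suc b mod 5" "d = Suc c mod 5" "e = Suc d mod 5" "a = Suc (Suc d) mod 5" for a b c d e
    proof (rule ccontr)
      assume "\<not> ?thesis"
      then have "f a = 2" "f b = 2" "f c = 2" "f d = 2"
        using f2[OF that(2)] f2[OF that(3)] f2[OF that(4)] f2[OF that(5)] by linarith+
      with chain[OF _ _ _ _ that(2-)] that(1) show False by blast
    qed
    have c0: "f 1 + f 2 + f 3 + f 4 \<le> 7"
      by (rule seven[OF pos(1)]) simp_all
    have c1: "f 2 + f 3 + f 4 + f 0 \<le> 7"
      by (rule seven[OF pos(2)]) simp_all
    have c2: "f 3 + f 4 + f 0 + f 1 \<le> 7"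
      by (rule seven[OF pos(3)]) simp_all
    have c3: "f 4 + f 0 + f 1 + f 2 \<le> 7"
      by (rule seven[OF pos(4)]) simp_all
    have c4: "f 0 + f 1 + f 2 + f 3 \<le> 7"
      by (rule seven[OF pos(5)]) simp_all
    show False
      using big c0 c1 c2 c3 c4 by linarith
  qed
  then show ?thesis
    by (simp add: f_def eval_nat_numeral)
qed

section \<open>Odd circuits\<close>

lemma sum_card_translates:
  fixes w :: "'b \<Rightarrow> 'a::exponent_two_group"
  assumes fin: "finite I" "finite X" and B: "B \<subseteq> X"
    and closed: "\<And>i x. i \<in> I \<Longrightarrow> x \<in> X \<Longrightarrow> x + w i \<in> X"
  shows "(\<Sum>x\<in>X. card {i \<in> I. x + w i \<in> B}) = card I * card B"
proof -
  have inner: "(\<Sum>x\<in>X. of_bool (x + w i \<in> B)) = card B" if i: "i \<in> I" for i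
  proof -
    have "(\<Sum>x\<in>X. of_bool (x + w i \<in> B)) = (\<Sum>x\<in>X. of_bool (x \<in> B) :: nat)"
      by (rule sum.reindex_bij_witness[of _ "\<lambda>x. x + w i" "\<lambda>x. x + w i"])
         (use closed i in \<open>auto simp: add.assoc\<close>)
    also have "\<dots> = card B"
      using B fin(2) by (simp add: Int_absorb1)
    finally show ?thesis .
  qed
  have "(\<Sum>x\<in>X. card {i \<in> I. x + w i \<in> B}) = (\<Sum>x\<in>X. \<Sum>i\<in>I. of_bool (x + w i \<in> B))"
    using fin(1) by (simp add: Int_def conj_commute)
  also have "\<dots> = (\<Sum>i\<in>I. \<Sum>x\<in>X. of_bool (x + w i \<in> B))"
    by (rule sum.swap)
  also have "\<dots> = card I * card B"
    using inner by simp
  finally show ?thesis .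
qed

text \<open>Averaging principle behind all density bounds on circuits: if every pattern
  \<open>x + w i\<close> meets \<open>B\<close> for at most \<open>m\<close> of the indices, then
  the density of \<open>B\<close> in \<open>X\<close> is at most m / |I|. The map \<open>w\<close>
  may repeat values.\<close>

lemma card_le_by_translates:
  fixes w :: "'b \<Rightarrow> 'a::exponent_two_group"
  assumes "finite I" "finite X" "B \<subseteq> X" "\<And>i x. i \<in> I \<Longrightarrow> x \<in> X \<Longrightarrow> x + w i \<in> X"
    and "\<And>x. x \<in> X \<Longrightarrow> card {i \<in> I. x + w i \<in> B} \<le> m"
  shows "card I * card B \<le> m * card X"
  using sum_card_translates[OF assms(1-4)] sum_bounded_above[of X "\<lambda>x. card {i \<in> I. x + w i \<in> B}" m] assms(5)
  by (simp add: mult.commute)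

lemma sum_sym_diff_even_subsets:
  fixes E :: "'a::exponent_two_group set"
  assumes "finite E" "S \<in> even_subsets E" "T \<in> even_subsets E"
  shows "\<Sum>(sym_diff S T) = \<Sum>S + \<Sum>T"
proof (rule sum_sym_diff)
  show "finite S" "finite T"
    using assms by (auto simp: even_subsets_def intro: finite_subset)
qed

lemma sum_complement_in_circuit:
  fixes E :: "'a::exponent_two_group set"
  assumes "finite E" "\<Sum>E = 0" "S \<subseteq> E"
  shows "\<Sum>(E - S) = \<Sum>S"
proof -
  have "\<Sum>(E - S) + \<Sum>S = 0"
    using sum.subset_diff[OF assms(3,1), of "\<lambda>x. x"] assms(2) by simp
  then show ?thesis by (simp add: add_eq_0_iff_eq)
qed

text \<open>The difference set is even and \<open>E\<close> is odd, so only the gap 1 has to be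
  excluded. If a single \<open>c\<close> were missing, the two points of \<open>B\<close> would
  differ by the sum of the difference set, which is \<open>c\<close> because \<open>E\<close> has
  sum 0; but \<open>B\<close> is independent in the Cayley graph of \<open>E\<close>.\<close>

lemma odd_circuit_sym_diff:
  fixes E :: "'a::exponent_two_group set"
  assumes E: "finite E" "odd (card E)" "\<Sum>E = 0" and B: "\<And>b c. b \<in> B \<Longrightarrow> c \<in> E \<Longrightarrow> b + c \<notin> B"
    and ST: "S \<in> even_subsets E" "T \<in> even_subsets E" "x + \<Sum>S \<in> B" "x + \<Sum>T \<in> B"
  shows "card (sym_diff S T) + 3 \<le> card E"
proof -
  let ?D = "sym_diff S T"
  have D: "?D \<subseteq> E" "even (card ?D)"
    using even_subsets_sym_diff[OF E(1) ST(1,2)] by (auto simp: even_subsets_def)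
  have fD: "finite ?D" using D(1) E(1) finite_subset by blast
  have "card ?D \<le> card E"
    using D(1) E(1) by (rule card_mono[rotated])
  moreover have "card ?D \<noteq> card E" using D(2) E(2) by metis
  moreover have "card ?D \<noteq> card E - 1"
  proof
    assume eq: "card ?D = card E - 1"
    have "card (E - ?D) = card E - card ?D"
      using fD D(1) by (rule card_Diff_subset)
    moreover have "card E > 0" using E(2) by (rule odd_pos)
    ultimately have "card (E - ?D) = 1" using eq by linarith
    then obtain c where c: "E - ?D = {c}" by (meson card_1_singletonE)
    have "\<Sum>?D = c"
      using sum_complement_in_circuit[OF E(1,3) D(1)] unfolding c by simp
    then have sc: "\<Sum>S + \<Sum>T = c"
      using sum_sym_diff_even_subsets[OF E(1) ST(1,2)] by simp
    have "(x + \<Sum>S) + c = x + \<Sum>T"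
      unfolding sc[symmetric] by (metis add.assoc add.commute add_self_left)
    moreover have "c \<in> E" using c by blast
    ultimately show False
      using B[OF ST(3)] ST(4) by metis
  qed
  moreover have "card E \<noteq> card ?D + 2"
    using D(2) E(2) by presburger
  ultimately show ?thesis by linarith
qed

text \<open>Here two selected even sets differ in at most two elements, so at most 5 of the 16 are
  selected.\<close>

lemma card_independent_five_circuit:
  fixes E :: "'a::exponent_two_group set"
  assumes E: "finite E" "card E = 5" "\<Sum>E = 0" and B: "\<And>b c. b \<in> B \<Longrightarrow> c \<in> E \<Longrightarrow> b + c \<notin> B"
  shows "card {S \<in> even_subsets E. x + \<Sum>S \<in> B} \<le> 5"
proof -
  have odd: "odd (card E)" using E(2) by simp
  have "card {S \<in> even_subsets E. x + \<Sum>S \<in> B} \<le> card E"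
  proof (rule card_even_subsets_diameter_two)
    fix S T assume ST: "S \<in> {S \<in> even_subsets E. x + \<Sum>S \<in> B}" "T \<in> {S \<in> even_subsets E. x + \<Sum>S \<in> B}"
    have "card (sym_diff S T) + 3 \<le> card E"
      by (rule odd_circuit_sym_diff[OF E(1) odd E(3) B]) (use ST in auto)
    then show "card (sym_diff S T) \<le> 2" using E(2) by simp
  qed (use E in auto)
  then show ?thesis using E(2) by simp
qed

lemma sum_even_subsets_translate:
  fixes E :: "'a::exponent_two_group set"
  assumes "finite E" "T \<in> even_subsets E"
  shows "(\<Sum>S\<in>even_subsets E. f (\<Sum>S + \<Sum>T)) = (\<Sum>S\<in>even_subsets E. f (\<Sum>S))"
  by (rule sum.reindex_bij_witness[of _ "\<lambda>S. sym_diff S T" "\<lambda>S. sym_diff S T"])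
     (use assms even_subsets_sym_diff[OF assms(1) _ assms(2)] sum_sym_diff_even_subsets[OF assms(1) _ assms(2)]
      in \<open>auto simp: add.assoc\<close>)

text \<open>The graph of \<open>five_cycle_square_bound\<close> is mapped into the Cayley graph by a
  closed walk on five elements of \<open>E\<close> and a square on the other two. At most 8 of its
  20 points lie in \<open>B\<close>, and this is averaged over all translates by sums of even
  subsets.\<close>

lemma card_independent_seven_circuit:
  fixes E :: "'a::exponent_two_group set"
  assumes E: "finite E" "card E = 7" "\<Sum>E = 0" and B: "\<And>b c. b \<in> B \<Longrightarrow> c \<in> E \<Longrightarrow> b + c \<notin> B"
  shows "card {S \<in> even_subsets E. x + \<Sum>S \<in> B} \<le> 25"
proof -
  let ?Ev = "even_subsets E"
  obtain e where e: "bij_betw e {..<7::nat} E"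
    using ex_bij_betw_nat_finite[OF E(1)] E(2) by (metis atLeast0LessThan)
  have eE: "e j \<in> E" if "j < 7" for j
    using e that by (auto simp: bij_betw_def)
  \<comment> \<open>Shifting by an element of \<open>W\<close> does not change the count
    \<open>N\<close>, since it only permutes the even subsets. \<open>W\<close> contains
    \<open>E\<close> itself: \<open>c\<close> is the sum of the six elements of
    \<open>E - {c}\<close>.\<close>
  define W where "W = sum (\<lambda>x. x) ` ?Ev"
  have W: "is_subgroup W"
    unfolding is_subgroup_def
  proof (intro conjI ballI)
    have "{} \<in> ?Ev" by (simp add: even_subsets_def)
    then show "0 \<in> W" unfolding W_def by (metis image_eqI sum.empty)
  next
    fix u v assume "u \<in> W" "v \<in> W"
    then show "u + v \<in> W"
      unfolding W_def using sum_sym_diff_even_subsets[OF E(1)] even_subsets_sym_diff[OF E(1)]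
      by (smt (verit) image_iff)
  qed
  have EW: "c \<in> W" if "c \<in> E" for c
  proof -
    have "E - {c} \<in> ?Ev"
      using that E by (simp add: even_subsets_def)
    moreover have "\<Sum>(E - {c}) = c"
      using sum_complement_in_circuit[OF E(1,3), of "{c}"] that by simp
    ultimately show ?thesis unfolding W_def by (metis image_eqI)
  qed
  define N where "N = (\<Sum>S\<in>?Ev. of_bool (x + \<Sum>S \<in> B) :: nat)"
  have N: "(\<Sum>S\<in>?Ev. of_bool (x + \<Sum>S + w \<in> B)) = N" if w: "w \<in> W" for w
  proof -
    obtain T where T: "T \<in> ?Ev" "w = \<Sum>T" using w unfolding W_def by blast
    show ?thesis
      using sum_even_subsets_translate[OF E(1) T(1), of "\<lambda>y. of_bool (x + y \<in> B)"]
      unfolding N_def T(2) by (simp add: add.assoc)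
  qed
  have cN: "card {S \<in> ?Ev. x + \<Sum>S \<in> B} = N"
    unfolding N_def using finite_even_subsets[OF E(1)] by (simp add: Int_def)
  define c where "c = e 5"
  define d where "d = e 6"
  \<comment> \<open>Consecutive points of the closed walk \<open>u\<close> differ by \<open>e j\<close> up to the diagonal \<open>c + d\<close> of the square
    \<open>{0, c, c + d, d}\<close>; this is the graph of \<open>five_cycle_square_bound\<close>.\<close>
  define u where "u j = (\<Sum>i<j. e i + c + d)" for j :: nat
  have cd: "c \<in> E" "d \<in> E" using eE by (auto simp: c_def d_def)
  have uW: "u j \<in> W" if "j \<le> 5" for j
    unfolding u_def using that cd EW eE is_subgroupD(2)[OF W] by (intro subgroup_sum_mem[OF W]) auto
  \<comment> \<open>The diagonal \<open>c + d\<close> occurs five times and so counts once, which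
    leaves the sum of all seven elements.\<close>
  have u5: "u 5 = 0"
  proof -
    have "\<Sum>E = (\<Sum>i<7. e i)"
      using sum.reindex_bij_betw[OF e, of "\<lambda>x. x"] by simp
    also have "\<dots> = u 5"
      by (simp add: u_def c_def d_def eval_nat_numeral add_ac)
    finally show ?thesis using E(3) by simp
  qed
  have u0: "u 0 = 0" by (simp add: u_def)
  have step: "u (Suc j mod 5) = u j + (e j + c + d)" if "j < 5" for j
  proof (cases "j = 4")
    case True
    then show ?thesis
      using u5 u0 by (simp add: u_def eval_nat_numeral)
  next
    case False
    then have "Suc j mod 5 = Suc j" using that by simp
    then show ?thesis by (simp add: u_def)
  qed
  have ind: "\<not> (y \<in> B \<and> z \<in> B)" if "z = y + a" "a \<in> E" for y z a
    using B that by blast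
  have local: "(\<Sum>j<5. of_bool (y + u j \<in> B) + of_bool (y + (u j + c + d) \<in> B) + of_bool (y + (u j + c) \<in> B)
      + of_bool (y + (u j + d) \<in> B) :: nat) \<le> 8" for y
  proof (rule five_cycle_square_bound)
    fix j :: nat assume j: "j < 5"
    have ej: "e j \<in> E" using eE j by simp
    show "\<not> (y + u j \<in> B \<and> y + (u (Suc j mod 5) + c + d) \<in> B)"
      by (rule ind[OF _ ej]) (simp add: step[OF j] add_ac)
    show "\<not> (y + (u j + c + d) \<in> B \<and> y + u (Suc j mod 5) \<in> B)"
      by (rule ind[OF _ ej]) (simp add: step[OF j] add_ac)
    show "\<not> (y + (u j + c) \<in> B \<and> y + (u (Suc j mod 5) + d) \<in> B)"
      by (rule ind[OF _ ej]) (simp add: step[OF j] add_ac)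
    show "\<not> (y + (u j + d) \<in> B \<and> y + (u (Suc j mod 5) + c) \<in> B)"
      by (rule ind[OF _ ej]) (simp add: step[OF j] add_ac)
    have "\<not> (y + u j \<in> B \<and> y + (u j + c) \<in> B)" "\<not> (y + u j \<in> B \<and> y + (u j + d) \<in> B)"
      "\<not> (y + (u j + c + d) \<in> B \<and> y + (u j + c) \<in> B)" "\<not> (y + (u j + c + d) \<in> B \<and> y + (u j + d) \<in> B)"
      by (rule ind[OF _ cd(1)] ind[OF _ cd(2)]; simp add: add_ac; fail)+
    then show "\<not> ((y + u j \<in> B \<or> y + (u j + c + d) \<in> B) \<and> (y + (u j + c) \<in> B \<or> y + (u j + d) \<in> B))"
      by blast
  qed
  let ?g = "\<lambda>y j. of_bool (y + u j \<in> B) + of_bool (y + (u j + c + d) \<in> B) + of_bool (y + (u j + c) \<in> B)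
      + of_bool (y + (u j + d) \<in> B) :: nat"
  have "(\<Sum>S\<in>?Ev. \<Sum>j<5. ?g (x + \<Sum>S) j) = (\<Sum>j<5. \<Sum>S\<in>?Ev. ?g (x + \<Sum>S) j)"
    by (rule sum.swap)
  also have "\<dots> = (\<Sum>j<5::nat. N + N + N + N)"
  proof (rule sum.cong[OF refl])
    fix j :: nat assume "j \<in> {..<5}"
    then have "u j \<in> W" using uW by simp
    then have "u j \<in> W" "u j + c + d \<in> W" "u j + c \<in> W" "u j + d \<in> W"
      using cd EW is_subgroupD(2)[OF W] by simp_all
    then show "(\<Sum>S\<in>?Ev. ?g (x + \<Sum>S) j) = N + N + N + N"
      using N by (simp only: sum.distrib)
  qed
  also have "\<dots> = 20 * N" by simp
  finally have "(\<Sum>S\<in>?Ev. \<Sum>j<5. ?g (x + \<Sum>S) j) = 20 * N" .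
  moreover have "(\<Sum>S\<in>?Ev. \<Sum>j<5. ?g (x + \<Sum>S) j) \<le> (\<Sum>S\<in>?Ev. 8)"
    by (intro sum_mono local)
  moreover have "card ?Ev = 64"
    using card_even_subsets[OF E(1) cd(1)] E(2) by simp
  \<comment> \<open>\<open>20 * N\<close> is at most 8 * 64 = 512, so \<open>N\<close> is at most 25
    by integrality.\<close>
  ultimately show ?thesis unfolding cN by simp
qed

text \<open>The partial sums of \<open>E\<close> give a closed walk of odd length
  \<open>2 * k + 1\<close>. As \<open>B\<close> contains no two consecutive points, it contains at
  most \<open>k\<close> of them, and averaging over the translates finishes.\<close>

lemma card_independent_odd_circuit:
  fixes E :: "'a::exponent_two_group set"
  assumes E: "finite E" "card E = 2 * k + 1" "\<Sum>E = 0" and B: "\<And>b c. b \<in> B \<Longrightarrow> c \<in> E \<Longrightarrow> b + c \<notin> B"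
    and X: "finite X" "B \<subseteq> X" "\<And>x c. x \<in> X \<Longrightarrow> c \<in> E \<Longrightarrow> x + c \<in> X"
  shows "(2 * k + 1) * card B \<le> k * card X"
proof -
  obtain e where e: "bij_betw e {..<2 * k + 1} E"
    using ex_bij_betw_nat_finite[OF E(1)] E(2) by (metis atLeast0LessThan)
  have eE: "e j \<in> E" if "j < 2 * k + 1" for j
    using e that by (auto simp: bij_betw_def)
  define u where "u j = (\<Sum>i<j. e i)" for j
  have un: "u (2 * k + 1) = 0"
    unfolding u_def using sum.reindex_bij_betw[OF e, of "\<lambda>x. x"] E(3) by simp
  have uX: "x + u j \<in> X" if "x \<in> X" "j \<le> 2 * k + 1" for x j
    using that(2)
  proof (induction j)
    case (Suc j)
    then have "x + u j + e j \<in> X" using X(3) eE by simp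
    then show ?case by (simp add: u_def add.assoc)
  qed (use that in \<open>simp add: u_def\<close>)
  have "card {..<2 * k + 1} * card B \<le> k * card X"
  proof (rule card_le_by_translates[of _ X _ u])
    fix x assume "x \<in> X"
    define f where "f j = (of_bool (x + u j \<in> B) :: nat)" for j
    have "f j + f (Suc j) \<le> 1" if "j < 2 * k + 1" for j
      using B[OF _ eE[OF that], of "x + u j"] by (auto simp: f_def u_def add.assoc)
    then have "(\<Sum>j<2 * k + 1. f j + f (Suc j)) \<le> (\<Sum>j<2 * k + 1. 1)"
      by (intro sum_mono) auto
    moreover have "(\<Sum>j<2 * k + 1. f (Suc j)) = (\<Sum>j<2 * k + 1. f j)"
    proof -
      have "f (2 * k + 1) = f 0"
        using un by (simp add: f_def u_def)
      then show ?thesis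
        using sum.lessThan_Suc_shift[of f "2 * k + 1"] sum.lessThan_Suc[of f "2 * k + 1"] by simp
    qed
    ultimately have "2 * (\<Sum>j<2 * k + 1. f j) \<le> 2 * k + 1"
      by (simp add: sum.distrib)
    then have "(\<Sum>j<2 * k + 1. f j) \<le> k" by linarith
    moreover have "(\<Sum>j\<in>J. f j) = card {j \<in> J. x + u j \<in> B}" if "finite J" for J
      using that by (simp add: f_def Int_def)
    ultimately show "card {j \<in> {..<2 * k + 1}. x + u j \<in> B} \<le> k"
      by (metis finite_lessThan)
  qed (use X uX in auto)
  then show ?thesis by simp
qed

text \<open>Let \<open>D\<close> be the difference of two selected sets. Replacing \<open>D\<close>
  in \<open>E\<close> by the two corresponding elements of \<open>C\<close> yields another odd
  zero-sum subset of \<open>C\<close>, with at most |E| - |D| + 2 elements. Minimality of |E| gives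
  |D| \<le> 2, and the diameter bound applies.\<close>

lemma card_shortest_odd_circuit_translates:
  fixes E :: "'a::exponent_two_group set"
  assumes E: "E \<subseteq> C" "finite E" "odd (card E)" "card E \<ge> 5" "\<Sum>E = 0"
    and short: "\<And>R. R \<subseteq> C \<Longrightarrow> odd (card R) \<Longrightarrow> \<Sum>R = 0 \<Longrightarrow> card E \<le> card R"
  shows "card {S \<in> even_subsets E. y + \<Sum>S \<in> C} \<le> card E"
proof (rule card_even_subsets_diameter_two)
  fix S T assume "S \<in> {S \<in> even_subsets E. y + \<Sum>S \<in> C}" "T \<in> {S \<in> even_subsets E. y + \<Sum>S \<in> C}"
  then have ST: "S \<in> even_subsets E" "T \<in> even_subsets E" "y + \<Sum>S \<in> C" "y + \<Sum>T \<in> C" by auto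
  let ?D = "sym_diff S T" and ?c = "y + \<Sum>S" and ?c' = "y + \<Sum>T"
  have D: "?D \<subseteq> E" "even (card ?D)"
    using even_subsets_sym_diff[OF E(2) ST(1,2)] by (auto simp: even_subsets_def)
  have fD: "finite ?D" using D(1) E(2) finite_subset by blast
  define R where "R = E - ?D"
  have R: "finite R" "R \<subseteq> C" "card R + card ?D = card E" "\<Sum>R = ?c + ?c'"
  proof -
    show "finite R" "R \<subseteq> C" using E by (auto simp: R_def)
    show "card R + card ?D = card E"
      using D(1) E(2) fD by (simp add: R_def card_Diff_subset card_mono)
    have "\<Sum>R = \<Sum>S + \<Sum>T"
      using sum_complement_in_circuit[OF E(2,5) D(1)] sum_sym_diff_even_subsets[OF E(2) ST(1,2)]
      by (simp add: R_def)
    also have "\<dots> = ?c + ?c'" by (metis add.assoc add.commute add_self_left)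
    finally show "\<Sum>R = ?c + ?c'" .
  qed
  \<comment> \<open>Toggling instead of inserting keeps both sum and parity right when
    \<open>?c\<close> and \<open>?c'\<close> coincide or already belong to \<open>R\<close>.\<close>
  define Q where "Q = sym_diff (sym_diff R {?c}) {?c'}"
  have f1: "finite (sym_diff R {?c})" using R(1) by simp
  have "\<Sum>Q = \<Sum>(sym_diff R {?c}) + ?c'"
    unfolding Q_def using sum_sym_diff[OF f1, of "{?c'}" "\<lambda>x. x"] by simp
  also have "\<Sum>(sym_diff R {?c}) = \<Sum>R + ?c"
    using sum_sym_diff[OF R(1), of "{?c}" "\<lambda>x. x"] by simp
  finally have "\<Sum>Q = 0"
    unfolding R(4) by (metis add.assoc add.commute add_self)
  moreover have "Q \<subseteq> C" using R(2) ST(3,4) by (auto simp: Q_def)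
  moreover have "odd (card Q)"
    unfolding Q_def using R(1,3) D(2) E(3) even_card_sym_diff[OF f1, of "{?c'}"] even_card_sym_diff[OF R(1), of "{?c}"]
    by (metis card.empty card.insert even_add even_zero finite.emptyI finite.insertI empty_iff odd_one One_nat_def)
  ultimately have "card E \<le> card Q" by (intro short)
  moreover have "card Q \<le> card R + 2"
    unfolding Q_def using card_sym_diff[OF f1, of "{?c'}"] card_sym_diff[OF R(1), of "{?c}"] by simp
  ultimately show "card ?D \<le> 2" using R(3) by linarith
qed (use E in auto)

lemma sum_free_quarter:
  assumes V: "is_subgroup V" "finite V" and A: "A \<subseteq> V" "sum_free A" "4 * card A > card V"
  shows "\<exists>W. is_subgroup W \<and> W \<subseteq> V \<and> card V \<le> 4 * card W \<and> A \<inter> W = {}"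
proof -
  have "A \<noteq> {}" using A(3) by auto
  then obtain H where H: "hyperplane H V" "card A * card V \<le> 2 * card (A - H) * card (V - A)"
    using sum_free_large_outside_hyperplane[OF V A(1,2)] by blast
  note sgH = hyperplaneD(1)[OF H(1)]
  have finA: "finite A" and finH: "finite H"
    using A(1) V(2) hyperplaneD(2)[OF H(1)] finite_subset by blast+
  have cV: "card (V - A) = card V - card A" "card A \<le> card V"
    using A(1) V(2) finA by (auto simp: card_Diff_subset card_mono)
  note cH = card_hyperplane[OF H(1) V]
  define B where "B = A - H"
  define C where "C = A \<inter> H"
  have BC: "card A = card C + card B"
    unfolding B_def C_def using card_Int_Diff[OF finA, of H] .
  have half: "2 * (card B + card C) > card H"
    using A(3) unfolding BC cH(2) by simp
  \<comment> \<open>If \<open>B\<close> had at most |V| / 6 elements, the Fourier inequality would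
    give 3|A| \<le> |V - A|, that is, density at most 1/4.\<close>
  have third: "3 * card B > card H"
  proof (rule ccontr)
    assume "\<not> ?thesis"
    then have "6 * card B \<le> card V" using cH(2) by linarith
    then have "(6 * card B) * card (V - A) \<le> card V * card (V - A)"
      by (rule mult_le_mono1)
    moreover have "3 * (card A * card V) \<le> 3 * (2 * card B * card (V - A))"
      using H(2) unfolding B_def by (rule mult_le_mono2)
    moreover have "3 * (2 * card B * card (V - A)) = (6 * card B) * card (V - A)"
      by simp
    ultimately have "3 * (card A * card V) \<le> card V * card (V - A)"
      by linarith
    then have "card V * (3 * card A) \<le> card V * card (V - A)"
      by (metis mult.assoc mult.commute)
    moreover have "card V > 0" using A(3) cV(2) by linarith
    ultimately have "3 * card A \<le> card (V - A)" by simp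
    then show False using A(3) cV by linarith
  qed
  show ?thesis
  proof (cases "\<exists>R. R \<subseteq> C \<and> odd (card R) \<and> \<Sum>R = 0")
    case False
    \<comment> \<open>\<open>D\<close> contains all sums of two elements of \<open>C\<close>, and it
      misses \<open>C\<close> because no odd subset has sum 0. A hyperplane of \<open>H\<close> that
      contains \<open>D\<close> and avoids one element of \<open>C\<close> therefore avoids all of
      them.\<close>
    define D where "D = sum (\<lambda>x. x) ` even_subsets C"
    have finC: "finite C" using finA by (simp add: C_def)
    have D: "is_subgroup D"
      unfolding is_subgroup_def
    proof (intro conjI ballI)
      have "{} \<in> even_subsets C" by (simp add: even_subsets_def)
      then show "0 \<in> D" unfolding D_def by (metis image_eqI sum.empty)
    next
      fix u v assume "u \<in> D" "v \<in> D"
      then show "u + v \<in> D"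
        unfolding D_def using sum_sym_diff_even_subsets[OF finC] even_subsets_sym_diff[OF finC]
        by (smt (verit) image_iff)
    qed
    have DH: "D \<subseteq> H"
      unfolding D_def C_def even_subsets_def by (auto intro!: subgroup_sum_mem[OF sgH])
    show ?thesis
    proof (cases "C = {}")
      case True
      then show ?thesis
        using sgH cH(2) hyperplaneD(2)[OF H(1)] by (intro exI[of _ H]) (auto simp: C_def)
    next
      case nonempty: False
      then obtain c where c: "c \<in> C" by blast
      have "c \<notin> D"
      proof
        assume "c \<in> D"
        then obtain R where R: "R \<subseteq> C" "even (card R)" "c = \<Sum>R"
          by (auto simp: D_def even_subsets_def)
        have fR: "finite R" using R(1) finC finite_subset by blast
        have "\<Sum>(sym_diff R {c}) = 0"
          using sum_sym_diff[OF fR, of "{c}" "\<lambda>x. x"] R(3) by simp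
        moreover have "odd (card (sym_diff R {c}))"
          using even_card_sym_diff[OF fR, of "{c}"] R(2) by simp
        moreover have "sym_diff R {c} \<subseteq> C" using R(1) c by blast
        ultimately show False using False by blast
      qed
      then obtain M where M: "hyperplane M H" "D \<subseteq> M" "c \<notin> M"
        using ex_hyperplane_avoiding[OF sgH finH D DH, of c] c by (auto simp: C_def)
      have "c' \<notin> M" if "c' \<in> C" for c'
      proof
        assume "c' \<in> M"
        have "c + c' \<in> M"
        proof (cases "c' = c")
          case True
          then show ?thesis using is_subgroupD(1)[OF hyperplaneD(1)[OF M(1)]] by simp
        next
          case False
          then have "{c, c'} \<in> even_subsets C" "\<Sum>{c, c'} = c + c'"
            using c that by (auto simp: even_subsets_def)
          then have "c + c' \<in> D" unfolding D_def by (metis image_eqI)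
          then show ?thesis using M(2) by blast
        qed
        then show False
          using subgroup_add_iff[OF hyperplaneD(1)[OF M(1)] \<open>c' \<in> M\<close>, of c] M(3) by (simp add: add.commute)
      qed
      then have "A \<inter> M = {}"
        using hyperplaneD(2)[OF M(1)] by (auto simp: C_def)
      moreover have "card V \<le> 4 * card M"
        using cH(2) card_hyperplane(2)[OF M(1) sgH finH] by simp
      ultimately show ?thesis
        using hyperplaneD(1,2)[OF M(1)] hyperplaneD(2)[OF H(1)] by blast
    qed
  next
    case True
    then obtain R0 where "R0 \<subseteq> C \<and> odd (card R0) \<and> \<Sum>R0 = 0" ..
    then obtain E where E': "E \<subseteq> C \<and> odd (card E) \<and> \<Sum>E = 0"
      and short': "\<forall>R. R \<subseteq> C \<and> odd (card R) \<and> \<Sum>R = 0 \<longrightarrow> card E \<le> card R"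
      using ex_has_least_nat[of "\<lambda>R. R \<subseteq> C \<and> odd (card R) \<and> \<Sum>R = 0" R0 card] by metis
    from E' have E: "E \<subseteq> C" "odd (card E)" "\<Sum>E = 0" by simp_all
    have short: "card E \<le> card R" if "R \<subseteq> C" "odd (card R)" "\<Sum>R = 0" for R
      using short' that by simp
    have finE: "finite E" using E(2) by (metis card.infinite even_zero)
    have A0: "0 \<notin> A" using A(2) unfolding sum_free_def by (metis add_self)
    \<comment> \<open>Size 1 would put 0 into \<open>A\<close>, and size 3 would give
      \<open>a = b + c\<close> within \<open>A\<close>; hence \<open>k\<close> is at least
      2.\<close>
    have "card E \<noteq> 1"
    proof
      assume "card E = 1"
      then obtain c where "E = {c}" by (meson card_1_singletonE)
      then show False using E A0 by (auto simp: C_def)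
    qed
    moreover have "card E \<noteq> 3"
    proof
      assume "card E = 3"
      then obtain a b c where abc: "E = {a, b, c}" "a \<noteq> b" "b \<noteq> c" "a \<noteq> c"
        using card_3_iff by metis
      then have "a = b + c" using E(3) by (simp add: add_eq_0_iff_eq)
      then show False using A(2) E(1) abc by (auto simp: C_def sum_free_def)
    qed
    moreover obtain k where k': "card E = 2 * k + 1" using E(2) by (rule oddE)
    ultimately have "k \<noteq> 0" "k \<noteq> 1" by auto
    with k' have k: "card E = 2 * k + 1" "k \<ge> 2" by simp_all
    have ind: "b + c \<notin> B" if "b \<in> B" "c \<in> E" for b c
      using A(2) that E(1) by (auto simp: B_def C_def sum_free_def)
    obtain c where "c \<in> E" using k(1) by fastforce
    then have Ev: "card (even_subsets E) = 4 ^ k"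
      using card_even_subsets[OF finE] k(1) by (simp add: power_mult)
    have EH: "E \<subseteq> H" using E(1) by (auto simp: C_def)
    have sumH: "\<Sum>S \<in> H" if "S \<in> even_subsets E" for S
      using that EH by (auto simp: even_subsets_def intro!: subgroup_sum_mem[OF sgH])
    have out: "x + h \<in> V - H" if "x \<in> V - H" "h \<in> H" for x h
      using hyperplane_add_out[OF H(1) V(1) that] .
    have B: "finite (V - H)" "B \<subseteq> V - H" using A(1) V(2) by (auto simp: B_def)
    have C: "C \<subseteq> H" by (simp add: C_def)
    have cC: "4 ^ k * card C \<le> (2 * k + 1) * card H"
      unfolding Ev[symmetric] k(1)[symmetric]
    proof (rule card_le_by_translates[OF finite_even_subsets[OF finE] finH C])
      show "x + \<Sum>S \<in> H" if "S \<in> even_subsets E" "x \<in> H" for S x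
        using that sumH is_subgroupD(2)[OF sgH] by blast
      show "card {S \<in> even_subsets E. x + \<Sum>S \<in> C} \<le> card E" for x
        using E finE k short by (intro card_shortest_odd_circuit_translates) auto
    qed
    have cB: "4 ^ k * card B \<le> m * card H"
      if "\<And>x. card {S \<in> even_subsets E. x + \<Sum>S \<in> B} \<le> m" for m
      unfolding Ev[symmetric] cH(1)[symmetric]
      using that out sumH by (intro card_le_by_translates[OF finite_even_subsets[OF finE] B]) auto
    \<comment> \<open>Relative to |H|: for \<open>k = 2\<close>, 5/16 is below the 1/3 of
      \<open>third\<close>; for \<open>k = 3\<close>, 25/64 + 7/64 is exactly the 1/2 of
      \<open>half\<close>; for larger \<open>k\<close>, \<open>pow\<close> makes k / (2k + 1) + (2k
      + 1) / 4^k at most 1/2. The inequality \<open>pow\<close> fails at \<open>k = 3\<close>, hence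
      the separate case.\<close>
    consider "k = 2" | "k = 3" | "k \<ge> 4" using k(2) by linarith
    then have False
    proof cases
      case 1
      have "4 ^ k * card B \<le> 5 * card H"
        using k(1) 1 by (intro cB card_independent_five_circuit[OF finE _ E(3) ind]) auto
      then show False using 1 third by simp
    next
      case 2
      have "4 ^ k * card B \<le> 25 * card H"
        using k(1) 2 by (intro cB card_independent_seven_circuit[OF finE _ E(3) ind]) auto
      then show False using 2 half cC by simp
    next
      case 3
      have "(2 * k + 1) * card B \<le> k * card (V - H)"
        by (rule card_independent_odd_circuit[OF finE k(1) E(3) ind B]) (use out EH in auto)
      then have b: "(2 * k + 1) * card B \<le> k * card H" using cH(1) by simp
      have pow: "2 * (2 * k + 1)\<^sup>2 \<le> 4 ^ k" using 3
      proof (induction k rule: dec_induct)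
        case (step n)
        have "(2 * Suc n + 1)\<^sup>2 \<le> (2 * (2 * n + 1))\<^sup>2"
          by (rule power_mono) (use step(1) in simp_all)
        also have "\<dots> = 4 * (2 * n + 1)\<^sup>2"
          by (simp only: power_mult_distrib) simp
        finally have "2 * (2 * Suc n + 1)\<^sup>2 \<le> 4 * (2 * (2 * n + 1)\<^sup>2)"
          by simp
        then show ?case using step by simp
      qed simp
      have "2 * (2 * k + 1) * ((2 * k + 1) * card C) = (2 * (2 * k + 1)\<^sup>2) * card C"
        by (simp add: power2_eq_square algebra_simps)
      also have "\<dots> \<le> 4 ^ k * card C" using pow by (rule mult_le_mono1)
      also have "\<dots> \<le> (2 * k + 1) * card H" by (rule cC)
      finally have "(2 * k + 1) * (2 * ((2 * k + 1) * card C)) \<le> (2 * k + 1) * card H"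
        by (simp only: mult_ac)
      then have "2 * ((2 * k + 1) * card C) \<le> card H"
        by (subst (asm) mult_le_cancel1) auto
      with b have "(2 * k + 1) * (2 * (card B + card C)) \<le> (2 * k + 1) * card H"
        by (simp add: algebra_simps)
      then have "2 * (card B + card C) \<le> card H"
        by (subst (asm) mult_le_cancel1) auto
      then show False using half by simp
    qed
    then show ?thesis ..
  qed
qed

section \<open>Projective geometries\<close>

text \<open>Linear independence of \<open>c\<close> is not demanded: it is automatic when \<open>0 \<notin> A\<close>.\<close>

definition PG_family :: "nat \<Rightarrow> (nat \<Rightarrow> 'a::exponent_two_group) \<Rightarrow> 'a set \<Rightarrow> bool" where
  "PG_family t c A \<longleftrightarrow> (\<forall>I\<subseteq>{..<t}. I \<noteq> {} \<longrightarrow> sum c I \<in> A)"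

definition PG_free :: "nat \<Rightarrow> 'a::exponent_two_group set \<Rightarrow> bool" where
  "PG_free t A \<longleftrightarrow> (\<nexists>c. PG_family t c A)"

text \<open>The subspace spanned by the first \<open>t\<close> values of \<open>c\<close>. It has
  fewer than 2^t elements if these are dependent, so only an upper bound on its size is
  available.\<close>

definition subset_sums :: "nat \<Rightarrow> (nat \<Rightarrow> 'a::exponent_two_group) \<Rightarrow> 'a set" where
  "subset_sums t c = sum c ` Pow {..<t}"

lemma is_subgroup_subset_sums: "is_subgroup (subset_sums t c)"
  unfolding is_subgroup_def
proof (intro conjI ballI)
  show "0 \<in> subset_sums t c"
    unfolding subset_sums_def by (metis Pow_bottom image_eqI sum.empty)
next
  fix x y assume "x \<in> subset_sums t c" "y \<in> subset_sums t c"
  then obtain I J where IJ: "I \<subseteq> {..<t}" "J \<subseteq> {..<t}" "x = sum c I" "y = sum c J"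
    by (auto simp: subset_sums_def)
  then have "x + y = sum c (sym_diff I J)"
    using finite_subset by (subst sum_sym_diff) auto
  moreover have "sym_diff I J \<subseteq> {..<t}" using IJ by blast
  ultimately show "x + y \<in> subset_sums t c"
    unfolding subset_sums_def by blast
qed

lemma finite_subset_sums: "finite (subset_sums t c)"
  by (simp add: subset_sums_def)

lemma card_subset_sums: "card (subset_sums t c) \<le> 2 ^ t"
  unfolding subset_sums_def using card_image_le[of "Pow {..<t}" "sum c"] by (simp add: card_Pow)

lemma subset_sums_PG_family:
  assumes "PG_family t c A"
  shows "subset_sums t c \<subseteq> insert 0 A"
proof
  fix x assume "x \<in> subset_sums t c"
  then obtain I where "I \<subseteq> {..<t}" "x = sum c I" unfolding subset_sums_def by blast
  then show "x \<in> insert 0 A"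
    using assms[unfolded PG_family_def, rule_format, of I] by (cases "I = {}") simp_all
qed

lemma subset_sums_update: "subset_sums t (c(t := x)) = subset_sums t c"
  unfolding subset_sums_def by (intro image_cong sum.cong) auto

lemma mem_subset_sums_Suc: "x \<in> subset_sums (Suc t) c \<longleftrightarrow> x \<in> subset_sums t c \<or> x + c t \<in> subset_sums t c"
proof
  assume "x \<in> subset_sums (Suc t) c"
  then obtain I where I: "I \<subseteq> {..<Suc t}" "x = sum c I" by (auto simp: subset_sums_def)
  then have fin: "finite I" using finite_subset by blast
  show "x \<in> subset_sums t c \<or> x + c t \<in> subset_sums t c"
  proof (cases "t \<in> I")
    case True
    have "x = c t + sum c (I - {t})" using I(2) sum.remove[OF fin True, of c] by simp
    then have "x + c t = sum c (I - {t})" by (simp add: add.commute)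
    moreover have "I - {t} \<subseteq> {..<t}" using I(1) by auto
    ultimately show ?thesis unfolding subset_sums_def by blast
  next
    case False
    then have "I \<subseteq> {..<t}" using I(1) by (auto simp: less_Suc_eq)
    then show ?thesis using I(2) unfolding subset_sums_def by blast
  qed
next
  have mono: "subset_sums t c \<subseteq> subset_sums (Suc t) c"
    unfolding subset_sums_def by (intro image_mono) auto
  have "c t \<in> subset_sums (Suc t) c"
    unfolding subset_sums_def by (rule image_eqI[of _ _ "{t}"]) auto
  moreover assume "x \<in> subset_sums t c \<or> x + c t \<in> subset_sums t c"
  ultimately show "x \<in> subset_sums (Suc t) c"
    using mono is_subgroupD(2)[OF is_subgroup_subset_sums, of "x + c t" "Suc t" c "c t"]
    by (auto simp: add.assoc)
qed

text \<open>A coset of the span lying inside \<open>A\<close> supplies all the new nonempty sums,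
  those that involve the index \<open>t\<close>.\<close>

lemma PG_family_Suc:
  assumes "PG_family t c A" "\<And>u. u \<in> subset_sums t c \<Longrightarrow> x + u \<in> A"
  shows "PG_family (Suc t) (c(t := x)) A"
  unfolding PG_family_def
proof (intro allI impI)
  fix I assume I: "I \<subseteq> {..<Suc t}" "I \<noteq> {}"
  then have fin: "finite I" using finite_subset by blast
  have eq: "sum (c(t := x)) (I - {t}) = sum c (I - {t})"
    by (intro sum.cong) auto
  have sub: "I - {t} \<subseteq> {..<t}" using I(1) by auto
  show "sum (c(t := x)) I \<in> A"
  proof (cases "t \<in> I")
    case True
    have "sum (c(t := x)) I = x + sum c (I - {t})"
      using sum.remove[OF fin True, of "c(t := x)"] eq by simp
    moreover have "sum c (I - {t}) \<in> subset_sums t c" using sub unfolding subset_sums_def by blast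
    ultimately show ?thesis using assms(2) by simp
  next
    case False
    then show ?thesis using eq sub I(2) assms(1) unfolding PG_family_def by simp
  qed
qed

lemma PG_family_mono: "PG_family t c A \<Longrightarrow> s \<le> t \<Longrightarrow> PG_family s c A"
  unfolding PG_family_def by (meson lessThan_subset_iff order_trans)

text \<open>If \<open>x\<close>, \<open>y\<close> and \<open>x + y\<close> all have their coset of
  the span inside \<open>A\<close>, adjoining first \<open>x\<close> and then \<open>y\<close>
  raises the rank by two, which freeness forbids.\<close>

lemma sum_free_PG_extensions:
  assumes c: "PG_family s c A" and free: "PG_free (Suc (Suc s)) A"
  shows "sum_free {x \<in> V. \<forall>u\<in>subset_sums s c. x + u \<in> A}"
  unfolding sum_free_def
proof (intro ballI notI)
  let ?A = "{x \<in> V. \<forall>u\<in>subset_sums s c. x + u \<in> A}"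
  fix x y assume x: "x \<in> ?A" and y: "y \<in> ?A" and xy: "x + y \<in> ?A"
  have fam: "PG_family (Suc s) (c(s := x)) A"
    using x by (intro PG_family_Suc[OF c]) auto
  have "PG_family (Suc (Suc s)) (c(s := x, Suc s := y)) A"
  proof (rule PG_family_Suc[OF fam])
    fix u assume "u \<in> subset_sums (Suc s) (c(s := x))"
    then consider "u \<in> subset_sums s c" | "u + x \<in> subset_sums s c"
      unfolding mem_subset_sums_Suc subset_sums_update by auto
    then show "y + u \<in> A"
    proof cases
      case 2
      then have "(x + y) + (u + x) \<in> A" using xy by blast
      then show ?thesis by (simp add: add_ac)
    qed (use y in blast)
  qed
  then show False using free unfolding PG_free_def by blast
qed

section \<open>Passing to a hyperplane when a geometry of one rank less is present\<close>

lemma card_le_sumset: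
  assumes "finite S" "finite X" and "\<And>x. x \<in> Y \<Longrightarrow> \<exists>u\<in>S. x + u \<in> X"
  shows "card (Y :: 'a::exponent_two_group set) \<le> card S * card X"
proof -
  have "Y \<subseteq> (\<lambda>(u, z). z + u) ` (S \<times> X)"
  proof
    fix x assume "x \<in> Y"
    then obtain u where "u \<in> S" "x + u \<in> X" using assms(3) by blast
    then show "x \<in> (\<lambda>(u, z). z + u) ` (S \<times> X)"
      by (intro image_eqI[of _ _ "(u, x + u)"]) (auto simp: add.assoc)
  qed
  then have "card Y \<le> card (S \<times> X)"
    using assms(1,2) by (intro surj_card_le) auto
  then show ?thesis by (simp add: card_cartesian_product)
qed

text \<open>Over the span of the first \<open>s\<close> vectors, the geometry has three
  one-dimensional extensions, by \<open>a\<close>, \<open>b\<close> and \<open>a + b\<close>. The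
  numbers of cosets spoiled by \<open>V - A\<close> are averaged over these three choices.\<close>

lemma ex_large_PG_extension:
  assumes V: "is_subgroup V" "finite V" and A: "A \<subseteq> V" "PG_free (Suc (Suc (Suc s))) A"
    "2 ^ (s + 3) * card (V - A) < 3 * card V"
    and c: "PG_family (Suc (Suc s)) c A"
  shows "\<exists>v. PG_family (Suc s) (c(s := v)) A \<and>
    card V < 3 * card {x \<in> V. \<forall>u\<in>subset_sums (Suc s) (c(s := v)). x + u \<in> A}"
proof -
  let ?S = "subset_sums s c"
  define a where "a = c s"
  define b where "b = c (Suc s)"
  \<comment> \<open>The points whose coset of \<open>?S\<close> is not contained in
    \<open>A\<close>. They number at most 2^s |V - A|, which is less than 3/8 of |V|.\<close>
  define X where "X = {x \<in> V. \<exists>u\<in>?S. x + u \<notin> A}"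
  define ext where "ext v = {x \<in> V. \<forall>u\<in>subset_sums (Suc s) (c(s := v)). x + u \<in> A}" for v
  have mem2: "x \<in> subset_sums (Suc (Suc s)) c \<longleftrightarrow> x \<in> ?S \<or> x + a \<in> ?S \<or> x + b \<in> ?S \<or> x + a + b \<in> ?S" for x
    by (auto simp: mem_subset_sums_Suc a_def b_def add_ac)
  have fam: "PG_family (Suc s) (c(s := v)) A" if v: "v \<in> {a, b, a + b}" for v
  proof (rule PG_family_Suc)
    show "PG_family s c A" using PG_family_mono[OF c] by simp
    fix u assume u: "u \<in> ?S"
    obtain I where I: "I \<subseteq> {..<s}" "u = sum c I" using u unfolding subset_sums_def by blast
    then have fin: "finite I" "s \<notin> I" "Suc s \<notin> I" using finite_subset by auto
    have "\<exists>J\<subseteq>{..<Suc (Suc s)}. J \<noteq> {} \<and> v + u = sum c J"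
    proof -
      consider "v = a" | "v = b" | "v = a + b" using v by blast
      then show ?thesis
      proof cases
        case 1 then show ?thesis using I fin by (intro exI[of _ "insert s I"]) (auto simp: a_def)
      next
        case 2 then show ?thesis using I fin by (intro exI[of _ "insert (Suc s) I"]) (auto simp: b_def)
      next
        case 3 then show ?thesis using I fin
          by (intro exI[of _ "insert s (insert (Suc s) I)"]) (auto simp: a_def b_def add.assoc)
      qed
    qed
    then obtain J where "J \<subseteq> {..<Suc (Suc s)}" "J \<noteq> {}" "v + u = sum c J" by blast
    then show "v + u \<in> A" using c[unfolded PG_family_def, rule_format, of J] by simp
  qed
  have "a \<in> A" "b \<in> A"
    using c[unfolded PG_family_def, rule_format, of "{s}"] c[unfolded PG_family_def, rule_format, of "{Suc s}"]
    by (auto simp: a_def b_def)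
  then have abV: "a \<in> V" "b \<in> V" "a + b \<in> V" using A(1) is_subgroupD(2)[OF V(1)] by auto
  have X_sub: "X \<subseteq> V" "finite X" using V(2) by (auto simp: X_def)
  have "card X \<le> card ?S * card (V - A)"
  proof (rule card_le_sumset[OF finite_subset_sums])
    fix x assume "x \<in> X"
    then obtain u where u: "x \<in> V" "u \<in> ?S" "x + u \<notin> A" unfolding X_def by blast
    have "?S \<subseteq> V"
      using subset_sums_PG_family[OF PG_family_mono[OF c, of s]] A(1) is_subgroupD(1)[OF V(1)] by auto
    then have "x + u \<in> V - A" using u is_subgroupD(2)[OF V(1)] by blast
    then show "\<exists>u\<in>?S. x + u \<in> V - A" using u by blast
  qed (use V in simp)
  also have "\<dots> \<le> 2 ^ s * card (V - A)" using card_subset_sums by (rule mult_le_mono1)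
  finally have "8 * card X \<le> 2 ^ (s + 3) * card (V - A)" by (simp add: power_add)
  with A(3) have X8: "8 * card X < 3 * card V" by linarith
  \<comment> \<open>The enlarged span is \<open>?S\<close> together with its translate by
    \<open>v\<close>, so the complement of \<open>ext v\<close> is the union of \<open>X\<close> and
    \<open>X\<close> translated by \<open>v\<close>.\<close>
  have ext_iff: "x \<in> V - ext v \<longleftrightarrow> x \<in> V \<and> (x \<in> X \<or> x + v \<in> X)" if "v \<in> V" for x v
  proof (cases "x \<in> V")
    case True
    have "(\<exists>u\<in>subset_sums (Suc s) (c(s := v)). x + u \<notin> A) \<longleftrightarrow>
        (\<exists>u\<in>?S. x + u \<notin> A) \<or> (\<exists>u\<in>?S. x + v + u \<notin> A)"
      unfolding mem_subset_sums_Suc Bex_def subset_sums_update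
      by (auto simp: add_ac) (metis add.commute add.left_commute add_self_left)+
    then show ?thesis
      using True that is_subgroupD(2)[OF V(1)] by (auto simp: ext_def X_def)
  qed simp
  let ?f = "\<lambda>x. of_bool (x \<in> X) :: nat"
  \<comment> \<open>The free shift \<open>w\<close> allows the same cardinality to be computed along
    both parallel edges of the square \<open>x\<close>, \<open>x + a\<close>, \<open>x + b\<close>,
    \<open>x + a + b\<close>; this is the factor 2 in the final count.\<close>
  have or_sum: "card (V - ext v) = (\<Sum>x\<in>V. of_bool (x + w \<in> X \<or> x + v + w \<in> X))"
    if "v \<in> V" "w \<in> V" for v w
  proof -
    have "card (V - ext v) = (\<Sum>x\<in>V. of_bool (x \<in> X \<or> x + v \<in> X))"
    proof -
      have "V - ext v = {x \<in> V. x \<in> X \<or> x + v \<in> X}"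
        using ext_iff[OF that(1)] by blast
      moreover have "card {x \<in> V. P x} = (\<Sum>x\<in>V. of_bool (P x))" for P
        using V(2) by (simp add: Int_def conj_commute)
      ultimately show ?thesis by presburger
    qed
    also have "\<dots> = (\<Sum>x\<in>V. of_bool (x + w \<in> X \<or> x + w + v \<in> X))"
      using sum_translate_subgroup[OF V(1) that(2), of "\<lambda>x. of_bool (x \<in> X \<or> x + v \<in> X) :: nat"] by simp
    finally show ?thesis by (simp add: add_ac)
  qed
  have f_sum: "(\<Sum>x\<in>V. ?f (x + w)) = card X" if "w \<in> V" for w
    using sum_translate_subgroup[OF V(1) that, of ?f] X_sub V(2) by (simp add: Int_absorb1)
  have ge1: "x \<in> X \<or> x + a \<in> X \<or> x + b \<in> X \<or> x + a + b \<in> X" if "x \<in> V" for x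
  proof (rule ccontr)
    assume none: "\<not> ?thesis"
    have V4: "x + a \<in> V" "x + b \<in> V" "x + a + b \<in> V" using that abV is_subgroupD(2)[OF V(1)] by auto
    have "PG_family (Suc (Suc (Suc s))) (c(Suc (Suc s) := x)) A"
    proof (rule PG_family_Suc[OF c])
      fix u assume "u \<in> subset_sums (Suc (Suc s)) c"
      then consider "u \<in> ?S" | "u + a \<in> ?S" | "u + b \<in> ?S" | "u + a + b \<in> ?S" unfolding mem2 by blast
      then show "x + u \<in> A"
      proof cases
        case 1 then show ?thesis using none that by (auto simp: X_def)
      next
        case 2
        then have "(x + a) + (u + a) \<in> A" using none V4 by (auto simp: X_def)
        then show ?thesis by (simp add: add_ac)
      next
        case 3
        then have "(x + b) + (u + b) \<in> A" using none V4 by (auto simp: X_def)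
        then show ?thesis by (simp add: add_ac)
      next
        case 4
        then have "(x + a + b) + (u + a + b) \<in> A" using none V4 unfolding X_def by blast
        then show ?thesis by (simp add: add_ac)
      qed
    qed
    then show False using A(2) unfolding PG_free_def by blast
  qed
  \<comment> \<open>The six pairs among four points, in the three matchings given by
    \<open>a\<close>, \<open>b\<close> and \<open>a + b\<close>. One, two, three or four points of
    \<open>X\<close> meet 3, 5, 6 or 6 of the pairs.\<close>
  have pointwise: "of_bool (p \<or> q) + of_bool (r \<or> z) + of_bool (p \<or> r) + of_bool (q \<or> z) + of_bool (p \<or> z) + of_bool (q \<or> r)
      \<le> 1 + 2 * (of_bool p + of_bool q + of_bool r + of_bool z :: nat)" if "p \<or> q \<or> r \<or> z" for p q r z
    using that by (cases p; cases q; cases r; cases z) simp_all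
  have "2 * (card (V - ext a) + card (V - ext b) + card (V - ext (a + b))) =
    (\<Sum>x\<in>V. of_bool (x \<in> X \<or> x + a \<in> X) + of_bool (x + b \<in> X \<or> x + a + b \<in> X)
      + of_bool (x \<in> X \<or> x + b \<in> X) + of_bool (x + a \<in> X \<or> x + a + b \<in> X)
      + of_bool (x \<in> X \<or> x + a + b \<in> X) + of_bool (x + a \<in> X \<or> x + b \<in> X))"
    using or_sum[of a 0] or_sum[of a b] or_sum[of b 0] or_sum[of b a] or_sum[of "a + b" 0] or_sum[of "a + b" a]
      abV is_subgroupD(1)[OF V(1)] by (simp add: sum.distrib add_ac)
  also have "\<dots> \<le> (\<Sum>x\<in>V. 1 + 2 * (?f x + ?f (x + a) + ?f (x + b) + ?f (x + a + b)))"
    by (intro sum_mono pointwise ge1)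
  also have "\<dots> = (\<Sum>x\<in>V. 1) + 2 * ((\<Sum>x\<in>V. ?f x) + (\<Sum>x\<in>V. ?f (x + a)) + (\<Sum>x\<in>V. ?f (x + b))
      + (\<Sum>x\<in>V. ?f (x + a + b)))"
    by (simp only: sum.distrib sum_distrib_left[symmetric])
  also have "\<dots> = card V + 8 * card X"
    using f_sum[of 0] f_sum[of a] f_sum[of b] f_sum[of "a + b"] abV is_subgroupD(1)[OF V(1)]
    by (simp add: add.assoc)
  finally have total: "card (V - ext a) + card (V - ext b) + card (V - ext (a + b)) < 2 * card V"
    using X8 by simp
  have "\<exists>v\<in>{a, b, a + b}. 3 * card (V - ext v) < 2 * card V"
  proof (rule ccontr)
    assume "\<not> ?thesis"
    then have "2 * card V \<le> 3 * card (V - ext a)" "2 * card V \<le> 3 * card (V - ext b)"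
      "2 * card V \<le> 3 * card (V - ext (a + b))"
      by (simp_all add: not_less)
    with total show False by linarith
  qed
  then obtain v where v: "v \<in> {a, b, a + b}" "3 * card (V - ext v) < 2 * card V" by blast
  have "ext v \<subseteq> V" by (auto simp: ext_def)
  have "card (V - ext v) + card (ext v) = card V"
    using V(2) by (metis Int_absorb1 \<open>ext v \<subseteq> V\<close> add.commute card_Int_Diff)
  then have "card V < 3 * card (ext v)" using v(2) by linarith
  then show ?thesis using fam[OF v(1)] unfolding ext_def by blast
qed

text \<open>Budget for the complement: it has fewer than 3|H| / 2^(s+2) elements in all, and at
  least 2|H| / 2^(s+2) of them lie in \<open>H\<close>, because each coset of \<open>S\<close> in
  \<open>H\<close> meets it. Fewer than |H| / 2^(s+2) remain outside \<open>H\<close>, too few to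
  block every extension of a rank \<open>s + 2\<close> geometry in
  \<open>A \<inter> H\<close>.\<close>

lemma ex_hyperplane_PG_free:
  assumes V: "is_subgroup V" "finite V" and A: "A \<subseteq> V" "PG_free (Suc (Suc (Suc s))) A"
    "2 ^ (s + 3) * card (V - A) < 3 * card V"
    and c: "PG_family (Suc (Suc s)) c A"
  shows "\<exists>H. hyperplane H V \<and> PG_free (Suc (Suc s)) (A \<inter> H)"
proof -
  obtain v where fam: "PG_family (Suc s) (c(s := v)) A"
    and big: "card V < 3 * card {x \<in> V. \<forall>u\<in>subset_sums (Suc s) (c(s := v)). x + u \<in> A}"
    using ex_large_PG_extension[OF assms] by blast
  define S where "S = subset_sums (Suc s) (c(s := v))"
  define A' where "A' = {x \<in> V. \<forall>u\<in>S. x + u \<in> A}"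
  have "sum_free A'"
    unfolding A'_def S_def by (rule sum_free_PG_extensions[OF fam A(2)])
  moreover have "A' \<subseteq> V" by (auto simp: A'_def)
  ultimately obtain H where H: "hyperplane H V" "A' \<inter> H = {}"
    using sum_free_third[OF V, of A'] big unfolding A'_def S_def by blast
  note cH = card_hyperplane[OF H(1) V]
  have S: "is_subgroup S" "finite S" "card S \<le> 2 ^ Suc s"
    unfolding S_def by (rule is_subgroup_subset_sums finite_subset_sums card_subset_sums)+
  have SV: "S \<subseteq> V"
    using subset_sums_PG_family[OF fam] A(1) is_subgroupD(1)[OF V(1)] by (auto simp: S_def)
  \<comment> \<open>\<open>A'\<close> is nonempty, invariant under \<open>S\<close> and disjoint
    from \<open>H\<close>; so \<open>x\<close> and \<open>x + u\<close> both lie outside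
    \<open>H\<close>, and their sum \<open>u\<close> lies in it.\<close>
  have SH: "S \<subseteq> H"
  proof
    fix u assume u: "u \<in> S"
    have "card A' \<noteq> 0" using big unfolding A'_def S_def by linarith
    then obtain x where x: "x \<in> A'" by fastforce
    then have xV: "x \<in> V - H" using H(2) by (auto simp: A'_def)
    have "x + u \<in> A'"
      using x u SV is_subgroupD(2)[OF S(1)] is_subgroupD(2)[OF V(1)] by (auto simp: A'_def add.assoc)
    then have "x + u \<notin> H" using H(2) by blast
    then show "u \<in> H" using hyperplaneD(4)[OF H(1) xV] u SV by blast
  qed
  have "card H \<le> card S * card ((V - A) \<inter> H)"
  proof (rule card_le_sumset[OF S(2)])
    fix x assume x: "x \<in> H"
    then have "x \<in> V" "x \<notin> A'" using H hyperplaneD(2)[OF H(1)] by auto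
    then obtain u where "u \<in> S" "x + u \<notin> A" by (auto simp: A'_def)
    moreover have "x + u \<in> H" using x \<open>u \<in> S\<close> SH is_subgroupD(2)[OF hyperplaneD(1)[OF H(1)]] by blast
    ultimately show "\<exists>u\<in>S. x + u \<in> (V - A) \<inter> H" using hyperplaneD(2)[OF H(1)] by blast
  qed (use V in simp)
  also have "\<dots> \<le> 2 ^ Suc s * card ((V - A) \<inter> H)" using S(3) by (rule mult_le_mono1)
  finally have inH: "card H \<le> 2 ^ Suc s * card ((V - A) \<inter> H)" .
  have "card (V - A) = card ((V - A) \<inter> H) + card (V - A - H)"
    using V(2) by (metis card_Int_Diff finite_Diff)
  then have outH: "2 ^ (s + 2) * card (V - A - H) < card H"
    using A(3) inH cH(2) by (simp add: power_add algebra_simps)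
  have "PG_free (Suc (Suc s)) (A \<inter> H)"
    unfolding PG_free_def
  proof
    assume "\<exists>d. PG_family (Suc (Suc s)) d (A \<inter> H)"
    then obtain d where d: "PG_family (Suc (Suc s)) d (A \<inter> H)" ..
    then have dA: "PG_family (Suc (Suc s)) d A" by (auto simp: PG_family_def)
    let ?D = "subset_sums (Suc (Suc s)) d"
    have DH: "?D \<subseteq> H"
      using subset_sums_PG_family[OF d] is_subgroupD(1)[OF hyperplaneD(1)[OF H(1)]] by auto
    have "card (V - H) \<le> card ?D * card (V - A - H)"
    proof (rule card_le_sumset[OF finite_subset_sums])
      fix x assume x: "x \<in> V - H"
      have "\<exists>u\<in>?D. x + u \<notin> A"
      proof (rule ccontr)
        assume "\<not> ?thesis"
        then have "PG_family (Suc (Suc (Suc s))) (d(Suc (Suc s) := x)) A"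
          by (intro PG_family_Suc[OF dA]) auto
        then show False using A(2) unfolding PG_free_def by blast
      qed
      then show "\<exists>u\<in>?D. x + u \<in> V - A - H"
        using hyperplane_add_out[OF H(1) V(1) x] DH by blast
    qed (use V in simp)
    also have "\<dots> \<le> 2 ^ (s + 2) * card (V - A - H)"
      using card_subset_sums[of "Suc (Suc s)" d] by (intro mult_le_mono1) simp
    finally show False using outH cH(1) by simp
  qed
  with H(1) show ?thesis by blast
qed

text \<open>Induction on the rank, written as \<open>s + 2\<close> so that it starts with sum-free
  sets. Passing to a hyperplane halves |V|, which the smaller power of 2 compensates, and doubles
  the index of the subgroup found.\<close>

lemma PG_free_disjoint_subgroup:
  assumes "is_subgroup V" "finite V" "A \<subseteq> V" "0 \<notin> A" "PG_free (s + 2) A"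
    "2 ^ (s + 2) * card (V - A) < 3 * card V"
  shows "\<exists>W. is_subgroup W \<and> W \<subseteq> V \<and> card V \<le> 2 ^ (s + 2) * card W \<and> A \<inter> W = {}"
  using assms
proof (induction s arbitrary: V A)
  case 0
  have "sum_free A"
    unfolding sum_free_def
  proof (intro ballI notI)
    fix x y assume xy: "x \<in> A" "y \<in> A" "x + y \<in> A"
    have "PG_family 2 (\<lambda>i. if i = 0 then x else y) A"
      unfolding PG_family_def
    proof (intro allI impI)
      fix I :: "nat set" assume "I \<subseteq> {..<2}" "I \<noteq> {}"
      then have "I = {0} \<or> I = {1} \<or> I = {0, 1}"
        by (auto simp: lessThan_nat_numeral lessThan_Suc)
      then show "(\<Sum>i\<in>I. if i = 0 then x else y) \<in> A"
        using xy by auto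
    qed
    then show False using 0(5) unfolding PG_free_def by (metis add_0)
  qed
  moreover have "card V = card A + card (V - A)"
    using 0 by (metis card_Diff_subset card_mono finite_subset le_add_diff_inverse)
  then have "4 * card A > card V" using 0 by simp
  ultimately show ?case
    using sum_free_quarter[OF 0(1,2,3)] by simp
next
  case (Suc s)
  have sub: "2 ^ (s + 2) * card (V - A) < 3 * card V"
    using Suc.prems(6) by simp
  show ?case
  proof (cases "PG_free (s + 2) A")
    case True
    then obtain W where "is_subgroup W" "W \<subseteq> V" "card V \<le> 2 ^ (s + 2) * card W" "A \<inter> W = {}"
      using Suc.IH[OF Suc.prems(1-4) True sub] by blast
    then show ?thesis by (intro exI[of _ W]) auto
  next
    case False
    then obtain c where "PG_family (Suc (Suc s)) c A" by (auto simp: PG_free_def)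
    then obtain H where H: "hyperplane H V" "PG_free (s + 2) (A \<inter> H)"
      using ex_hyperplane_PG_free[OF Suc.prems(1-3), of s c] Suc.prems(5,6) by (auto simp: eval_nat_numeral)
    note cH = card_hyperplane[OF H(1) Suc.prems(1,2)]
    have "card (H - A \<inter> H) \<le> card (V - A)"
      using Suc.prems(2) hyperplaneD(2)[OF H(1)] by (intro card_mono) auto
    then have "2 ^ (s + 2) * card (H - A \<inter> H) \<le> 2 ^ (s + 2) * card (V - A)"
      by (rule mult_le_mono2)
    moreover have "2 * (2 ^ (s + 2) * card (V - A)) < 2 * (3 * card H)"
      using Suc.prems(6) cH(2) by simp
    ultimately have "2 ^ (s + 2) * card (H - A \<inter> H) < 3 * card H" by linarith
    then obtain W where "is_subgroup W" "W \<subseteq> H" "card H \<le> 2 ^ (s + 2) * card W" "A \<inter> H \<inter> W = {}"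
      using Suc.IH[OF hyperplaneD(1)[OF H(1)], of "A \<inter> H"] H(2) Suc.prems(2,4) hyperplaneD(2)[OF H(1)] finite_subset
      by (metis IntD1 Int_lower2)
    then show ?thesis
      using hyperplaneD(2)[OF H(1)] cH(2) by (intro exI[of _ W]) (auto simp: mult_ac)
  qed
qed

section \<open>Binary matroids\<close>

instance bit :: exponent_two_group
proof
  fix x :: bit
  show "x + x = 0" by (cases x) simp_all
qed

instance "fun" :: (type, exponent_two_group) exponent_two_group
  by standard (simp add: fun_eq_iff)

lemma UNIV_bit: "(UNIV :: bit set) = {0, 1}"
proof -
  have "b = 0 \<or> b = 1" for b :: bit by (cases b) simp_all
  then show ?thesis by auto
qed

lemma finite_UNIV_bit: "finite (UNIV :: bit set)" and card_UNIV_bit: "card (UNIV :: bit set) = 2"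
  by (simp_all add: UNIV_bit)

text \<open>Coordinates with respect to a finite basis. This translates the codimension in the
  critical number into cardinalities.\<close>

lemma (in vectorspace) card_carrier_eq_power_dim:
  assumes K: "finite (carrier K)" and V: "finite (carrier V)"
  shows "card (carrier V) = card (carrier K) ^ dim"
proof -
  have "span (carrier V) = carrier V"
    using in_own_span[of "carrier V"] span_is_subset2[of "carrier V"] by auto
  then have "fin_dim"
    unfolding fin_dim_def using V by blast
  then obtain B where B: "finite B" "basis B"
    using finite_basis_exists by blast
  then have BV: "B \<subseteq> carrier V" by (simp add: basis_def)
  have ex1: "\<exists>!a. a \<in> B \<rightarrow>\<^sub>E carrier K \<and> lincomb a B = v" if "v \<in> carrier V" for v
    using basis_criterion[OF B(1) BV] B(2) that by blast
  have "bij_betw (\<lambda>a. lincomb a B) (B \<rightarrow>\<^sub>E carrier K) (carrier V)"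
    unfolding bij_betw_def
  proof
    have closed: "lincomb a B \<in> carrier V" if "a \<in> B \<rightarrow>\<^sub>E carrier K" for a
      using that BV by (intro lincomb_closed) auto
    show "inj_on (\<lambda>a. lincomb a B) (B \<rightarrow>\<^sub>E carrier K)"
    proof (rule inj_onI)
      fix a b assume ab: "a \<in> B \<rightarrow>\<^sub>E carrier K" "b \<in> B \<rightarrow>\<^sub>E carrier K" "lincomb a B = lincomb b B"
      show "a = b"
        using ex1[OF closed[OF ab(1)]] ab by metis
    qed
    show "(\<lambda>a. lincomb a B) ` (B \<rightarrow>\<^sub>E carrier K) = carrier V"
    proof
      show "(\<lambda>a. lincomb a B) ` (B \<rightarrow>\<^sub>E carrier K) \<subseteq> carrier V" using closed by blast
      show "carrier V \<subseteq> (\<lambda>a. lincomb a B) ` (B \<rightarrow>\<^sub>E carrier K)" using ex1 by blast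
    qed
  qed
  then have "card (carrier V) = card (B \<rightarrow>\<^sub>E carrier K)"
    using bij_betw_same_card by metis
  also have "\<dots> = card (carrier K) ^ card B"
    by (rule card_funcsetE[OF B(1)])
  finally show ?thesis using dim_basis[OF B] by simp
qed

text \<open>Addition on \<open>bit vec\<close> is not a group structure on the type, so vectors of length \<open>r\<close> are
  replaced by functions supported below \<open>r\<close>.\<close>

definition supported_below :: "nat \<Rightarrow> (nat \<Rightarrow> bit) set" where
  "supported_below r = {f. \<forall>i\<ge>r. f i = 0}"

lemma vec_plus_fun: "vec r (f + g :: nat \<Rightarrow> 'a::plus) = vec r f + vec r g"
  by (intro eq_vecI) auto

lemma is_subgroup_supported_below: "is_subgroup (supported_below r)"
  by (auto simp: is_subgroup_def supported_below_def)

lemma bij_betw_vec_supported_below: "bij_betw (vec r) (supported_below r) (carrier_vec r)"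
proof (rule bij_betw_byWitness[where f' = "\<lambda>v i. if i < r then v $ i else 0"])
  show "\<forall>f\<in>supported_below r. (\<lambda>i. if i < r then vec r f $ i else 0) = f"
    by (auto simp: supported_below_def fun_eq_iff)
  show "\<forall>v\<in>carrier_vec r. vec r (\<lambda>i. if i < r then v $ i else 0) = v"
    by (auto intro!: eq_vecI)
  show "vec r ` supported_below r \<subseteq> carrier_vec r"
    by auto
  show "(\<lambda>v i. if i < r then v $ i else 0) ` carrier_vec r \<subseteq> supported_below r"
    by (auto simp: supported_below_def)
qed

section \<open>Counting in spaces of bit vectors\<close>

lemma finite_supported_below: "finite (supported_below r)"
proof -
  have "finite {f :: nat \<Rightarrow> bit. \<forall>i. (i \<in> {..<r} \<longrightarrow> f i \<in> UNIV) \<and> (i \<notin> {..<r} \<longrightarrow> f i = 0)}"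
    by (rule finite_set_of_finite_funs) (simp_all add: finite_UNIV_bit)
  then show ?thesis
    by (rule rev_finite_subset) (auto simp: supported_below_def)
qed

lemma finite_carrier_vec_bit: "finite (carrier_vec r :: bit vec set)"
  using bij_betw_finite[OF bij_betw_vec_supported_below] finite_supported_below by blast

lemma vectorspace_F2_space: "vectorspace class_ring (F2_space r)"
  by (rule vec_vs)

lemma card_F2_subspace:
  assumes "VectorSpace.subspace class_ring W (F2_space r)"
  shows "card W = 2 ^ vectorspace.dim class_ring ((F2_space r)\<lparr>carrier := W\<rparr>)"
proof -
  interpret V: vectorspace class_ring "F2_space r" by (rule vectorspace_F2_space)
  interpret W: vectorspace class_ring "(F2_space r)\<lparr>carrier := W\<rparr>"
    by (rule V.subspace_is_vs[OF assms])
  have "W \<subseteq> carrier_vec r"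
    using assms unfolding VectorSpace.subspace_def submodule_def by (auto simp: module_vec_simps)
  then have "finite W"
    using finite_carrier_vec_bit finite_subset by blast
  then show ?thesis
    using W.card_carrier_eq_power_dim by (simp add: finite_UNIV_bit card_UNIV_bit)
qed

lemma card_carrier_vec_bit: "card (carrier_vec r :: bit vec set) = 2 ^ r"
proof -
  interpret V: vec_space "TYPE(bit)" r .
  have "card (carrier_vec r :: bit vec set) = card (UNIV :: bit set) ^ V.dim"
    using V.card_carrier_eq_power_dim finite_carrier_vec_bit by (simp add: finite_UNIV_bit)
  then show ?thesis unfolding card_UNIV_bit V.dim_is_n .
qed

lemma F2_subspaceI:
  assumes "W \<subseteq> carrier_vec r" "0\<^sub>v r \<in> W" "\<And>v w. v \<in> W \<Longrightarrow> w \<in> W \<Longrightarrow> v + w \<in> W"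
  shows "VectorSpace.subspace class_ring W (F2_space r)"
proof -
  interpret V: vectorspace class_ring "F2_space r" by (rule vectorspace_F2_space)
  have "c \<cdot>\<^sub>v v \<in> W" if "v \<in> W" for c :: bit and v
  proof (cases c)
    case zero
    have "dim_vec v = r" using that assms(1) by auto
    then have "c \<cdot>\<^sub>v v = 0\<^sub>v r" using zero by auto
    then show ?thesis using assms(2) by simp
  qed (use that in simp)
  then show ?thesis
    unfolding VectorSpace.subspace_def submodule_def
    using assms vectorspace_F2_space V.module_axioms by (auto simp: module_vec_simps)
qed

text \<open>A vector is sent to the sum of \<open>c\<close> over its support. Nonzero vectors land
  in the ground set, which lacks 0, so the kernel is trivial and independence of \<open>c\<close>
  comes for free.\<close>

lemma PG_family_contains_binary_PG:
  assumes c: "PG_family t c {f \<in> supported_below (mrank M). vec (mrank M) f \<in> ground M}"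
    and zero: "0\<^sub>v (mrank M) \<notin> ground M"
  shows "contains_matroid M (binary_PG t)"
proof -
  let ?r = "mrank M"
  define supp :: "bit vec \<Rightarrow> nat set" where "supp x = {i. i < t \<and> x $ i = 1}" for x
  define \<iota> where "\<iota> x = vec ?r (sum c (supp x))" for x
  have supp_add: "supp (x + y) = sym_diff (supp x) (supp y)" if "x \<in> carrier_vec t" "y \<in> carrier_vec t" for x y
    using that by (auto simp: supp_def elim!: bit_not_one_iff[THEN iffD1, rotated])
  have fin: "finite (supp x)" and sub: "supp x \<subseteq> {..<t}" for x by (auto simp: supp_def)
  have add: "\<iota> (x + y) = \<iota> x + \<iota> y" if "x \<in> carrier_vec t" "y \<in> carrier_vec t" for x y
    unfolding \<iota>_def supp_add[OF that] sum_sym_diff[OF fin fin] by (rule vec_plus_fun)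
  have zero_vec: "\<iota> (0\<^sub>v t) = 0\<^sub>v ?r"
  proof -
    have "supp (0\<^sub>v t) = {}" by (auto simp: supp_def)
    then show ?thesis by (intro eq_vecI) (simp_all add: \<iota>_def)
  qed
  have smult: "\<iota> (b \<cdot>\<^sub>v x) = b \<cdot>\<^sub>v \<iota> x" if "x \<in> carrier_vec t" for b x
  proof (cases b)
    case zero
    then have "b \<cdot>\<^sub>v x = 0\<^sub>v t" "b \<cdot>\<^sub>v \<iota> x = 0\<^sub>v ?r" using that by (auto simp: \<iota>_def)
    then show ?thesis using zero_vec by simp
  qed simp
  have image: "\<iota> x \<in> ground M" if x: "x \<in> carrier_vec t" "x \<noteq> 0\<^sub>v t" for x
  proof -
    have "supp x \<noteq> {}"
    proof
      assume "supp x = {}"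
      then have "x = 0\<^sub>v t" using x(1) by (intro eq_vecI) (auto simp: supp_def)
      then show False using x(2) by simp
    qed
    then show ?thesis
      using c sub unfolding PG_family_def \<iota>_def by blast
  qed
  have inj: "inj_on \<iota> (carrier_vec t)"
  proof (rule inj_onI)
    fix x y assume xy: "x \<in> carrier_vec t" "y \<in> carrier_vec t" "\<iota> x = \<iota> y"
    have "\<iota> (x + y) = \<iota> x + \<iota> x" using add[OF xy(1,2)] xy(3) by simp
    also have "\<dots> = 0\<^sub>v ?r" by (intro eq_vecI) (auto simp: \<iota>_def)
    finally have "x + y = 0\<^sub>v t" using image[of "x + y"] zero xy(1,2) by auto
    then have "x $ i + y $ i = 0" if "i < t" for i
      using xy(1,2) that by (metis carrier_vecD index_add_vec(1) index_zero_vec(1))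
    then have "x $ i = y $ i" if "i < t" for i
      using that by (simp only: add_eq_0_iff_eq)
    then show "x = y" using xy(1,2) by (intro eq_vecI) auto
  qed
  have lin: "linear_map class_ring (F2_space t) (F2_space ?r) \<iota>"
    unfolding linear_map_def mod_hom_def mod_hom_axioms_def LinearCombinations.module_hom_def
    using vectorspace_F2_space vec_module[where 'a = bit] add smult
    by (auto simp: module_vec_simps \<iota>_def)
  have "\<iota> ` (carrier_vec t - {0\<^sub>v t}) \<subseteq> ground M" using image by blast
  with lin inj show ?thesis
    unfolding contains_matroid_def binary_PG_def by auto
qed

text \<open>The upper bound comes from a disjoint subgroup of index at most 2^t. The lower bound is
  a count: with r the rank, a disjoint subspace of codimension k has 2^(r-k) elements, all in the
  complement of the ground set, which has fewer than 3 * 2^(r-t).\<close>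

theorem theorem1p4:
  fixes t :: nat and M :: bin_matroid
  assumes "t \<ge> 2"
    and "binary_matroid M"
    and "matroid_free (binary_PG t) M"
    and "real (card (ground M)) > (1 - 3 / 2 ^ t) * 2 ^ mrank M"
  shows "critical_number M \<in> {t - 1, t}"
proof -
  let ?r = "mrank M"
  let ?P = "\<lambda>k. \<exists>W. F2_subspace_codim ?r k W \<and> W \<inter> ground M = {}"
  have ground: "ground M \<subseteq> carrier_vec ?r" "0\<^sub>v ?r \<notin> ground M"
    using assms(2) by (auto simp: binary_matroid_def)
  define A where "A = {f \<in> supported_below ?r. vec ?r f \<in> ground M}"
  note bij = bij_betw_vec_supported_below[of ?r]
  have inj: "inj_on (vec ?r) (supported_below ?r)" and surj: "vec ?r ` supported_below ?r = carrier_vec ?r"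
    using bij by (auto simp: bij_betw_def)
  have cV: "card (supported_below ?r) = 2 ^ ?r"
    using bij_betw_same_card[OF bij] card_carrier_vec_bit by simp
  have "vec ?r ` A = ground M"
    using surj ground(1) by (auto simp: A_def)
  moreover have "inj_on (vec ?r) A"
    using inj by (rule inj_on_subset) (auto simp: A_def)
  ultimately have cA: "card A = card (ground M)"
    by (metis card_image)
  have A: "A \<subseteq> supported_below ?r" "0 \<notin> A"
  proof -
    have "vec ?r (0 :: nat \<Rightarrow> bit) = 0\<^sub>v ?r" by (intro eq_vecI) auto
    then show "A \<subseteq> supported_below ?r" "0 \<notin> A" using ground(2) by (auto simp: A_def)
  qed
  have free: "PG_free t A"
    unfolding PG_free_def A_def using PG_family_contains_binary_PG ground(2) assms(3) by blast
  have pow: "(2::real) ^ t > 0" by simp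
  have dense: "(2::real) ^ t * 2 ^ ?r < 2 ^ t * real (card (ground M)) + 3 * 2 ^ ?r"
    using mult_strict_left_mono[OF assms(4) pow] by (simp add: algebra_simps)
  have "card (supported_below ?r - A) + card A = 2 ^ ?r"
    using A(1) finite_supported_below cV by (metis Int_absorb1 add.commute card_Int_Diff)
  then have "real (card (supported_below ?r - A)) + real (card (ground M)) = 2 ^ ?r"
    unfolding cA by (metis of_nat_add of_nat_numeral of_nat_power)
  then have "2 ^ t * real (card (supported_below ?r - A)) + 2 ^ t * real (card (ground M)) = 2 ^ t * 2 ^ ?r"
    by (metis distrib_left)
  with dense have "2 ^ t * real (card (supported_below ?r - A)) < 3 * 2 ^ ?r" by linarith
  then have "real (2 ^ t * card (supported_below ?r - A)) < real (3 * 2 ^ ?r)" by simp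
  then have "2 ^ t * card (supported_below ?r - A) < 3 * card (supported_below ?r)"
    unfolding cV of_nat_less_iff .
  moreover obtain s where s: "t = s + 2" using assms(1) by (metis add.commute le_Suc_ex)
  ultimately obtain W where W: "is_subgroup W" "W \<subseteq> supported_below ?r" "2 ^ ?r \<le> 2 ^ t * card W" "A \<inter> W = {}"
    using PG_free_disjoint_subgroup[OF is_subgroup_supported_below finite_supported_below A, of s] free cV by metis
  define U where "U = vec ?r ` W"
  have "card U = card W"
    unfolding U_def using inj W(2) by (intro card_image) (rule inj_on_subset)
  have "U \<subseteq> carrier_vec ?r" by (auto simp: U_def)
  have subspace: "VectorSpace.subspace class_ring U (F2_space ?r)"
  proof (rule F2_subspaceI)
    show "U \<subseteq> carrier_vec ?r" by fact
    have "vec ?r (0 :: nat \<Rightarrow> bit) = 0\<^sub>v ?r" by (intro eq_vecI) auto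
    then show "0\<^sub>v ?r \<in> U" unfolding U_def using is_subgroupD(1)[OF W(1)] by (metis image_eqI)
    show "v + w \<in> U" if "v \<in> U" "w \<in> U" for v w
      using that is_subgroupD(2)[OF W(1)] unfolding U_def by (auto simp flip: vec_plus_fun)
  qed
  define d where "d = vectorspace.dim class_ring ((F2_space ?r)\<lparr>carrier := U\<rparr>)"
  have cU: "card U = 2 ^ d"
    unfolding d_def by (rule card_F2_subspace[OF subspace])
  have "card U \<le> 2 ^ ?r"
    using card_mono[OF finite_carrier_vec_bit \<open>U \<subseteq> carrier_vec ?r\<close>] card_carrier_vec_bit by simp
  then have "d \<le> ?r" unfolding cU by simp
  have "(2::nat) ^ ?r \<le> 2 ^ (t + d)"
    using W(3) \<open>card U = card W\<close> cU by (simp add: power_add)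
  then have "?r \<le> t + d" by simp
  have "U \<inter> ground M = {}"
    using W(2,4) unfolding U_def A_def by auto
  then have "?P (?r - d)"
    using subspace \<open>d \<le> ?r\<close> unfolding F2_subspace_codim_def d_def by auto
  then have "critical_number M \<le> ?r - d" and ex: "?P (critical_number M)"
    unfolding critical_number_def by (rule Least_le, rule LeastI)
  then have upper: "critical_number M \<le> t" using \<open>?r \<le> t + d\<close> by linarith
  obtain Y where Y: "F2_subspace_codim ?r (critical_number M) Y" "Y \<inter> ground M = {}" using ex by blast
  define e where "e = vectorspace.dim class_ring ((F2_space ?r)\<lparr>carrier := Y\<rparr>)"
  have e: "VectorSpace.subspace class_ring Y (F2_space ?r)" "e + critical_number M = ?r"
    using Y(1) by (auto simp: F2_subspace_codim_def e_def)
  have cY: "card Y = 2 ^ e"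
    unfolding e_def by (rule card_F2_subspace[OF e(1)])
  have Ysub: "Y \<subseteq> carrier_vec ?r"
    using e(1) unfolding VectorSpace.subspace_def submodule_def by (auto simp: module_vec_simps)
  have fin: "finite Y" "finite (ground M)"
    using Ysub ground(1) finite_carrier_vec_bit finite_subset by blast+
  have "card (Y \<union> ground M) \<le> 2 ^ ?r"
    using card_mono[OF finite_carrier_vec_bit, of "Y \<union> ground M" ?r] Ysub ground(1) card_carrier_vec_bit by auto
  then have "2 ^ e + card (ground M) \<le> 2 ^ ?r"
    using card_Un_disjoint[OF fin Y(2)] cY by simp
  then have "real (2 ^ e + card (ground M)) \<le> real (2 ^ ?r)" by (rule of_nat_mono)
  then have "(2::real) ^ e + real (card (ground M)) \<le> 2 ^ ?r" by simp
  then have "2 ^ t * ((2::real) ^ e + real (card (ground M))) \<le> 2 ^ t * 2 ^ ?r"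
    by (intro mult_left_mono) auto
  \<comment> \<open>Rounding 3 up to 4 turns the count into \<open>t + e < 2 + ?r\<close>, so the
    critical number \<open>?r - e\<close> exceeds \<open>t - 2\<close>.\<close>
  with dense have "(2::real) ^ t * 2 ^ e < 3 * 2 ^ ?r" by (simp add: distrib_left)
  also have "\<dots> < 4 * 2 ^ ?r" by simp
  finally have "(2::real) ^ (t + e) < 2 ^ (2 + ?r)" by (simp add: power_add)
  then have "t + e < 2 + ?r" by (rule power_less_imp_less_exp[rotated]) simp
  then show ?thesis using upper e(2) by auto
qed

end
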